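(* For every integer $b\ge 2$ and every $d>0$, the space $L^2(\mu_{b,d})$ admits a Fourier frame if and only if $b$ is even.
   Context: For an integer $b\ge2$ and $d>0$, $\mu_{b,d}$ denotes the Bernoulli convolution with contraction ratio $1/b$, i.e. the infinite convolution $$\mu_{b,d}=\ast_{j=1}^{\infty}\tfrac12\bigl(\delta_{-d b^{-j}/2}+\delta_{d b^{-j}/2}\bigr).$$ Equivalently, $\mu_{b,d}$ is the Borel probability measure on $\mathbb R$ which is the distribution of $\sum_{j=1}^\infty \frac{d\xi_j b^{-j}}{2}$, where $\xi_1,\xi_2,\ldots$ are independent and each is uniformly distributed on $\{-1,1\}$. For a compactly supported Borel probability measure $\mu$ on $\mathbb R$, $L^2(\mu)$ is the complex Hilbert space with inner product $\langle f,g\rangle_{L^2(\mu)}=\int_{\mathbb R} f\,\overline{g}\,d\mu$, and $e_\lambda(x)=e^{2\pi i\lambda x}$ for $\lambda\in\mathbb R$. A countable set $\Lambda\subset\mathbb R$ is a Fourier frame spectrum for $\mu$ if there exist constants $0<A\le C<\infty$ such that $$A\|f\|_{L^2(\mu)}^2\le\sum_{\lambda\in\Lambda}|\langle f,e_\lambda\rangle_{L^2(\mu)}|^2\le C\|f\|_{L^2(\mu)}^2\quad\text{for all } f\in L^2(\mu).$$ $L^2(\mu)$ admits a Fourier frame if some Fourier frame spectrum for $\mu$ exists. *)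

theory Defs
  imports "HOL-Probability.Probability"
begin

(* The law of \<Sum>j\<ge>1. d * \<xi>_j * b^(-j) / 2 for independent fair signs \<xi>_j, realised on the
   product space; the coordinate \<xi> n is the sign with index n + 1. *)
definition bernoulli_convolution :: "nat \<Rightarrow> real \<Rightarrow> real measure" where
  "bernoulli_convolution b d =
     distr (\<Pi>\<^sub>M n\<in>(UNIV :: nat set). measure_pmf (pmf_of_set {-1, 1 :: real})) borel
       (\<lambda>\<xi>. \<Sum>n. d * \<xi> n / real b ^ Suc n / 2)"

(* The map under distr is measurable, so distr does not degenerate. *)
lemma prob_space_bernoulli_convolution: "prob_space (bernoulli_convolution b d)"
proof -
  let ?M = "\<Pi>\<^sub>M n\<in>(UNIV :: nat set). measure_pmf (pmf_of_set {-1, 1 :: real})"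
  interpret prob_space ?M
    by (intro prob_space_PiM prob_space_measure_pmf)
  have "(\<lambda>\<xi>. \<xi> n) \<in> borel_measurable ?M" for n
    by (rule measurable_compose[OF measurable_component_singleton]) auto
  then have "(\<lambda>\<xi>. \<Sum>n. d * \<xi> n / real b ^ Suc n / 2) \<in> borel_measurable ?M"
    by (intro borel_measurable_suminf borel_measurable_divide borel_measurable_times) auto
  then show ?thesis
    unfolding bernoulli_convolution_def by (rule prob_space_distr)
qed

(* Elements of L^2(\<mu>) are represented by functions rather than by a.e.-equivalence classes;
   everything below depends on a function only up to \<mu>-null sets. *)
definition L2_space :: "real measure \<Rightarrow> (real \<Rightarrow> complex) set" where
  "L2_space \<mu> = {f \<in> borel_measurable \<mu>. integrable \<mu> (\<lambda>x. (cmod (f x))\<^sup>2)}"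

definition L2_inner :: "real measure \<Rightarrow> (real \<Rightarrow> complex) \<Rightarrow> (real \<Rightarrow> complex) \<Rightarrow> complex" where
  "L2_inner \<mu> f g = (LINT x|\<mu>. f x * cnj (g x))"

definition L2_norm :: "real measure \<Rightarrow> (real \<Rightarrow> complex) \<Rightarrow> real" where
  "L2_norm \<mu> f = sqrt (LINT x|\<mu>. (cmod (f x))\<^sup>2)"

definition exponential :: "real \<Rightarrow> real \<Rightarrow> complex" where
  "exponential t x = exp (2 * of_real pi * \<i> * of_real t * of_real x)"

(* infsum of a divergent family is 0, so finiteness of the frame sum is stated separately. *)
definition fourier_frame_spectrum :: "real measure \<Rightarrow> real set \<Rightarrow> bool" where
  "fourier_frame_spectrum \<mu> \<Lambda> \<longleftrightarrow>
     countable \<Lambda> \<and>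
     (\<exists>A C. 0 < A \<and> A \<le> C \<and>
       (\<forall>f \<in> L2_space \<mu>.
          (\<lambda>t. (cmod (L2_inner \<mu> f (exponential t)))\<^sup>2) summable_on \<Lambda> \<and>
          A * (L2_norm \<mu> f)\<^sup>2 \<le> (\<Sum>\<^sub>\<infinity>t\<in>\<Lambda>. (cmod (L2_inner \<mu> f (exponential t)))\<^sup>2) \<and>
          (\<Sum>\<^sub>\<infinity>t\<in>\<Lambda>. (cmod (L2_inner \<mu> f (exponential t)))\<^sup>2) \<le> C * (L2_norm \<mu> f)\<^sup>2))"

definition admits_fourier_frame :: "real measure \<Rightarrow> bool" where
  "admits_fourier_frame \<mu> \<longleftrightarrow> (\<exists>\<Lambda>. fourier_frame_spectrum \<mu> \<Lambda>)"

end

theory Submission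
  imports Defs
begin

text \<open>
  Let \<open>\<xi>\<close> be a sequence of independent fair signs and
  \<open>X \<xi> = (\<Sum>n. d * \<xi> n / (2 * b ^ (n + 1)))\<close>, so that the measure is the law of \<open>X\<close> and
  \<open>L\<^sup>2\<close> of it sits inside \<open>L\<^sup>2\<close> of the space of signs. Splitting off the first sign expresses a
  Fourier coefficient at \<open>t\<close> through coefficients at \<open>t / b\<close> of functions of the remaining signs
  (\<open>coef_first_sign\<close>). With the angles \<open>\<phi>\<^sub>n = pi * d * t / b ^ (n + 1)\<close>, the squared
  coefficient of the constant 1 is the product of all \<open>cos\<^sup>2 \<phi>\<^sub>n\<close>, and multiplying
  the function by the sign \<open>\<xi> n\<close> replaces the factor \<open>cos\<^sup>2 \<phi>\<^sub>n\<close> by \<open>sin\<^sup>2 \<phi>\<^sub>n\<close>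
  (\<open>sign_coefficients\<close>).

  Odd ratio. Here \<open>b \<ge> 3\<close>, so the signs are functions of \<open>X\<close> (\<open>digit_X\<close>). Given a frame with
  bounds \<open>A\<close> and \<open>C\<close>, compare the unit vectors \<open>1\<close>, \<open>\<xi> (n + 1)\<close> and \<open>\<xi> n * \<xi> (n + 1)\<close>. The squared
  coefficients of \<open>1\<close> are summable, hence their sum outside some finite set \<open>F\<close> of frequencies is
  tiny. On \<open>F\<close> the angle \<open>\<phi>\<^sub>n\<^sub>+\<^sub>1\<close> tends to 0, so for large \<open>n\<close> nearly all of the frame sum of
  \<open>\<xi> (n + 1)\<close>, which is at least \<open>A\<close>, comes from outside \<open>F\<close>, and there only frequencies with
  \<open>cos\<^sup>2 \<phi>\<^sub>n\<^sub>+\<^sub>1\<close> much smaller than \<open>sin\<^sup>2 \<phi>\<^sub>n\<^sub>+\<^sub>1\<close> can matter. Since \<open>b\<close> is odd and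
  \<open>\<phi>\<^sub>n = b * \<phi>\<^sub>n\<^sub>+\<^sub>1\<close>, one has \<open>\<bar>cos \<phi>\<^sub>n\<bar> \<le> b * \<bar>cos \<phi>\<^sub>n\<^sub>+\<^sub>1\<bar>\<close>, so \<open>cos\<^sup>2 \<phi>\<^sub>n\<close> is small there as
  well. Replacing it by \<open>sin\<^sup>2 \<phi>\<^sub>n\<close> multiplies these contributions by a huge factor, and the frame
  sum of \<open>\<xi> n * \<xi> (n + 1)\<close> exceeds \<open>C\<close>. For even \<open>b\<close> the argument breaks down because
  \<open>\<bar>cos \<phi>\<^sub>n\<bar>\<close> is then close to 1.

  Even ratio. The frequencies are \<open>b / (2 * d)\<close> times the integers
  \<open>\<Sum>k. a k * (- b) ^ k\<close> with digits \<open>a k \<in> {0, 1}\<close>, almost all of them 0. For functions of the first \<open>n\<close> signs,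
  the sum of the squared coefficients over the \<open>2 ^ n\<close> frequencies with \<open>n\<close> digits is comparable to
  the squared norm: splitting off the first sign and the lowest digit turns the claim into the
  parallelogram law, up to the remaining factors \<open>cos\<^sup>2 \<phi>\<^sub>k\<close> for \<open>k \<ge> n\<close>
  (\<open>finite_parseval\<close>). The alternating signs keep the frequencies with \<open>n\<close> digits so close to 0,
  relative to \<open>b ^ n\<close>, that the product of those factors is at least \<open>1 / 16\<close> (\<open>abs_freq_le\<close>,
  \<open>coef_one_lower_bound\<close>), also for \<open>b = 2\<close>. Functions of finitely many signs are dense, so both
  bounds pass to all of \<open>L\<^sup>2\<close> with worse constants.
\<close>

section \<open>Elementary inequalities\<close>

text \<open>
  An odd multiple of an odd multiple of \<open>pi / 2\<close> is again one, so \<open>cos (n * x)\<close> vanishes wherever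
  \<open>cos x\<close> does; the factor \<open>n\<close> makes this quantitative.
\<close>
lemma abs_cos_odd_multiple_le:
  assumes "odd n"
  shows "\<bar>cos (real n * x)\<bar> \<le> real n * \<bar>cos x\<bar>"
proof -
  have "\<bar>cos (real (2 * k + 1) * x)\<bar> \<le> real (2 * k + 1) * \<bar>cos x\<bar>" for k
  proof (induction k)
    case (Suc k)
    let ?y = "real (2 * k + 1) * x"
    have "real (2 * Suc k + 1) * x = ?y + 2 * x"
      by (simp add: algebra_simps)
    then have "\<bar>cos (real (2 * Suc k + 1) * x)\<bar> = \<bar>cos ?y * cos (2 * x) - sin ?y * sin (2 * x)\<bar>"
      by (simp only: cos_add)
    also have "\<dots> \<le> \<bar>cos ?y\<bar> * \<bar>cos (2 * x)\<bar> + \<bar>sin ?y\<bar> * \<bar>sin (2 * x)\<bar>"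
      unfolding abs_mult[symmetric] by (rule abs_triangle_ineq4)
    also have "\<dots> \<le> \<bar>cos ?y\<bar> * 1 + 1 * (2 * \<bar>cos x\<bar>)"
    proof (intro add_mono mult_mono)
      have "\<bar>sin x\<bar> * \<bar>cos x\<bar> \<le> 1 * \<bar>cos x\<bar>"
        by (intro mult_right_mono) auto
      then show "\<bar>sin (2 * x)\<bar> \<le> 2 * \<bar>cos x\<bar>"
        by (simp add: sin_double abs_mult)
    qed auto
    also have "\<dots> \<le> real (2 * Suc k + 1) * \<bar>cos x\<bar>"
      using Suc.IH by (simp add: algebra_simps)
    finally show ?case .
  qed simp
  with assms show ?thesis by (metis oddE)
qed

text \<open>
  Applied with \<open>c\<close>, \<open>s\<close> the squared cosine and sine of one angle and \<open>c'\<close>, \<open>s'\<close> those of its odd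
  multiple. Either \<open>s \<le> K * c\<close>, and the first summand suffices, or \<open>c\<close> is so small that \<open>c'\<close> is
  small compared with \<open>s'\<close>, and the second one does. The coefficient of the second summand tends to
  0 as \<open>K\<close> grows.
\<close>
lemma transfer_inequality:
  fixes u c s c' s' B K :: real
  assumes "u \<ge> 0" "0 \<le> c" "0 \<le> s" "0 \<le> c'" "0 \<le> s'" "c + s = 1" "c' + s' = 1" "c' \<le> B * c" "0 \<le> B" "B \<le> K"
  shows "u * c' * s \<le> K * (u * c' * c) + B / (K + 1 - B) * (u * s' * s)"
proof -
  have "c' * s \<le> K * c' * c + B / (K + 1 - B) * s' * s"
  proof (cases "s \<le> K * c")
    case True
    have "c' * s \<le> c' * (K * c)"
      using True assms by (intro mult_left_mono) auto
    moreover have "0 \<le> B / (K + 1 - B) * s' * s"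
      using assms by auto
    ultimately show ?thesis by (simp add: mult_ac)
  next
    case False
    then have c: "c * (K + 1) \<le> 1"
      using assms by (simp add: algebra_simps)
    have "c' * (K + 1) \<le> B * (c * (K + 1))"
      using assms(8) mult_right_mono[OF assms(8), of "K + 1"] assms by (simp add: mult_ac)
    also have "\<dots> \<le> B * 1"
      using c assms by (intro mult_left_mono) auto
    finally have "c' * (K + 1) \<le> B * (c' + s')"
      using assms by simp
    then have "c' * (K + 1 - B) \<le> B * s'"
      by (simp add: algebra_simps)
    then have "c' \<le> B / (K + 1 - B) * s'"
      using assms by (simp add: field_simps)
    then have "c' * s \<le> B / (K + 1 - B) * s' * s"
      using assms by (intro mult_right_mono) auto
    moreover have "0 \<le> K * c' * c"
      using assms by auto
    ultimately show ?thesis by linarith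
  qed
  from mult_left_mono[OF this assms(1)] show ?thesis
    by (simp add: algebra_simps)
qed

lemma cos_ge_half: "\<bar>x\<bar> \<le> pi / 3 \<Longrightarrow> 1 / 2 \<le> cos x"
  using cos_monotone_0_pi_le[of "\<bar>x\<bar>" "pi / 3"] by (simp add: cos_60)

lemma norm_add_sq_le: "(cmod (x + y))\<^sup>2 \<le> 2 * (cmod x)\<^sup>2 + 2 * (cmod y)\<^sup>2"
proof -
  have "(cmod (x + y))\<^sup>2 \<le> (cmod x + cmod y)\<^sup>2"
    by (intro power_mono norm_triangle_ineq) simp
  also have "\<dots> \<le> 2 * (cmod x)\<^sup>2 + 2 * (cmod y)\<^sup>2"
    using zero_le_power2[of "cmod x - cmod y"] by (simp add: power2_eq_square algebra_simps)
  finally show ?thesis .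
qed

lemma sum_off_finite_set_small:
  fixes f :: "'a \<Rightarrow> real"
  assumes "f summable_on L" "\<epsilon> > 0"
  obtains F where "finite F" "F \<subseteq> L" "infsum f (L - F) < \<epsilon>"
proof -
  have "(sum f \<longlongrightarrow> infsum f L) (finite_subsets_at_top L)"
    using assms(1) by (simp add: has_sum_def[symmetric])
  then have "eventually (\<lambda>F. dist (sum f F) (infsum f L) < \<epsilon>) (finite_subsets_at_top L)"
    using assms(2) by (rule tendstoD)
  then obtain F where F: "finite F" "F \<subseteq> L" "dist (sum f F) (infsum f L) < \<epsilon>"
    unfolding eventually_finite_subsets_at_top by blast
  have "infsum f (L - F) = infsum f L - sum f F"
    using F assms(1) by (subst infsum_Diff) auto
  with F that[of F] show thesis by (simp add: dist_real_def)
qed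

section \<open>Independent fair signs\<close>

definition signs :: "(nat \<Rightarrow> real) measure" where
  "signs = (\<Pi>\<^sub>M n\<in>(UNIV :: nat set). measure_pmf (pmf_of_set {-1, 1 :: real}))"

interpretation signs: sequence_space "measure_pmf (pmf_of_set {-1, 1 :: real})"
  by unfold_locales

lemma prob_space_signs: "prob_space signs"
  unfolding signs_def by (intro prob_space_PiM prob_space_measure_pmf)

interpretation signs_prob: prob_space signs
  by (rule prob_space_signs)

lemma space_signs [simp]: "space signs = UNIV"
  by (simp add: signs_def space_PiM)

lemma measurable_coord [measurable]: "(\<lambda>\<xi>. \<xi> n) \<in> borel_measurable signs"
  unfolding signs_def by (rule measurable_compose[OF measurable_component_singleton]) auto

lemma measurable_case_nat_signs [measurable]: "(\<lambda>\<xi>. case_nat s \<xi>) \<in> measurable signs signs"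
proof -
  have "(\<lambda>\<xi>. case_nat s \<xi>) \<in> measurable signs (\<Pi>\<^sub>M n\<in>(UNIV :: nat set). measure_pmf (pmf_of_set {-1, 1 :: real}))"
    unfolding signs_def by (rule measurable_case_nat') auto
  then show ?thesis by (simp add: signs_def)
qed

lemma AE_signs: "AE \<xi> in signs. \<forall>n. \<xi> n \<in> {-1, 1}"
  unfolding signs_def AE_all_countable
  by (intro allI signs.AE_component) (auto simp: AE_measure_pmf_iff)

text \<open>
  The law of the signs is preserved by prepending an independent sign, so Fubini applies to the
  first sign and the rest.
\<close>
lemma
  fixes F :: "(nat \<Rightarrow> real) \<Rightarrow> 'a::{banach, second_countable_topology}"
  assumes F: "integrable signs F"
  shows integrable_first_sign: "s \<in> {-1, 1} \<Longrightarrow> integrable signs (\<lambda>\<xi>. F (case_nat s \<xi>))"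
    and integral_first_sign: "(LINT \<xi>|signs. F \<xi>) =
      ((LINT \<xi>|signs. F (case_nat 1 \<xi>)) + (LINT \<xi>|signs. F (case_nat (-1) \<xi>))) /\<^sub>R 2"
proof -
  let ?C = "measure_pmf (pmf_of_set {-1, 1 :: real})"
  let ?f = "\<lambda>(s, \<omega>). case_nat s \<omega>"
  interpret pair_sigma_finite ?C signs
    by unfold_locales
  have iter: "distr (?C \<Otimes>\<^sub>M signs) signs ?f = signs"
    using signs.PiM_iter by (simp add: signs_def)
  have meas: "?f \<in> measurable (?C \<Otimes>\<^sub>M signs) signs"
    unfolding signs_def by measurable
  have int: "integrable (?C \<Otimes>\<^sub>M signs) (\<lambda>p. F (?f p))"
    using F by (subst (asm) iter[symmetric]) (simp add: integrable_distr_eq meas F[THEN borel_measurable_integrable])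
  have "(LINT \<xi>|signs. F \<xi>) = integral\<^sup>L (?C \<Otimes>\<^sub>M signs) (\<lambda>p. F (?f p))"
    by (subst iter[symmetric], subst integral_distr[OF meas]) (use F in auto)
  also have "\<dots> = (LINT s|?C. LINT \<xi>|signs. F (case_nat s \<xi>))"
    by (subst integral_fst'[OF int, symmetric]) simp
  also have "\<dots> = ((LINT \<xi>|signs. F (case_nat 1 \<xi>)) + (LINT \<xi>|signs. F (case_nat (-1) \<xi>))) /\<^sub>R 2"
    by (subst integral_measure_pmf[of "{-1, 1}"]) (auto simp: scaleR_add_right)
  finally show "(LINT \<xi>|signs. F \<xi>) =
      ((LINT \<xi>|signs. F (case_nat 1 \<xi>)) + (LINT \<xi>|signs. F (case_nat (-1) \<xi>))) /\<^sub>R 2" .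
  show "integrable signs (\<lambda>\<xi>. F (case_nat s \<xi>))" if "s \<in> {-1, 1}"
    using AE_integrable_fst'[OF int] that by (auto simp: AE_measure_pmf_iff)
qed

lemma abs_sign:
  fixes \<xi> :: "nat \<Rightarrow> real"
  assumes "\<forall>n. \<xi> n \<in> {-1, 1}"
  shows "\<bar>\<xi> n\<bar> = 1"
  using assms[rule_format, of n] by auto

lemma integrable_signs_bounded:
  fixes F :: "(nat \<Rightarrow> real) \<Rightarrow> 'a::{banach, second_countable_topology}"
  assumes "F \<in> borel_measurable signs" "\<And>\<xi>. \<forall>n. \<xi> n \<in> {-1, 1} \<Longrightarrow> norm (F \<xi>) \<le> B"
  shows "integrable signs F"
proof (rule signs_prob.integrable_const_bound[of _ B])
  show "AE \<xi> in signs. norm (F \<xi>) \<le> B"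
    using AE_signs by eventually_elim (rule assms(2))
qed (rule assms(1))

section \<open>Fourier coefficients against the law of the random series\<close>

lemma exponential_add: "exponential t (x + y) = exponential t x * exponential t y"
  by (simp add: exponential_def algebra_simps flip: exp_add)

lemma exponential_scale: "exponential t (x / c) = exponential (t / c) x"
  by (simp add: exponential_def)

lemma exponential_cis: "exponential t x = cis (2 * pi * t * x)"
  by (simp add: exponential_def cis_conv_exp mult_ac)

lemma norm_exponential [simp]: "cmod (exponential t x) = 1"
  by (simp add: exponential_cis)

lemma measurable_exponential [measurable]: "exponential t \<in> borel_measurable borel"
  unfolding exponential_cis by (intro borel_measurable_continuous_onI continuous_intros)

lemma cnj_exponential: "cnj (exponential t x) = exponential (- t) x"
  by (simp add: exponential_cis cis_cnj)

locale bernoulli_sum =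
  fixes b :: nat and d :: real
  assumes b_ge_2: "b \<ge> 2" and d_pos: "d > 0"
begin

definition X :: "(nat \<Rightarrow> real) \<Rightarrow> real" where
  "X \<xi> = (\<Sum>n. d * \<xi> n / real b ^ Suc n / 2)"

definition coef :: "((nat \<Rightarrow> real) \<Rightarrow> complex) \<Rightarrow> real \<Rightarrow> complex" where
  "coef F t = (LINT \<xi>|signs. F \<xi> * cnj (exponential t (X \<xi>)))"

lemma b_pos: "real b > 0" and b_real: "real b \<ge> 2"
  using b_ge_2 by auto

lemma X_measurable [measurable]: "X \<in> borel_measurable signs"
  unfolding X_def by (intro borel_measurable_suminf borel_measurable_divide borel_measurable_times) auto

lemma distr_X: "bernoulli_convolution b d = distr signs borel X"
  unfolding bernoulli_convolution_def signs_def X_def ..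

lemma sums_geometric: "(\<lambda>n. d / real b ^ Suc n / 2) sums (d / (2 * (real b - 1)))"
proof -
  have eq: "d / real b ^ Suc n / 2 = d / (2 * b) * (1 / real b) ^ n" for n
    by (simp add: power_divide)
  have lim: "d / (2 * (real b - 1)) = d / (2 * b) * (1 / (1 - 1 / real b))"
    using b_real by (simp add: field_simps)
  show ?thesis
    unfolding eq lim using b_real by (intro sums_mult geometric_sums) auto
qed

lemma
  assumes "\<forall>n. \<xi> n \<in> {-1, 1}"
  shows summable_X: "summable (\<lambda>n. d * \<xi> n / real b ^ Suc n / 2)"
    and abs_X_le: "\<bar>X \<xi>\<bar> \<le> d / (2 * (real b - 1))"
proof -
  have eq: "\<bar>d * \<xi> n / real b ^ Suc n / 2\<bar> = d / real b ^ Suc n / 2" for n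
  proof -
    have "\<bar>\<xi> n\<bar> = 1" using assms[rule_format, of n] by auto
    then show ?thesis using d_pos by (simp add: abs_mult)
  qed
  note geometric = sums_summable[OF sums_geometric] sums_unique[OF sums_geometric, symmetric]
  show "summable (\<lambda>n. d * \<xi> n / real b ^ Suc n / 2)"
    by (rule summable_rabs_cancel) (simp only: eq geometric)
  have "\<bar>X \<xi>\<bar> \<le> (\<Sum>n. \<bar>d * \<xi> n / real b ^ Suc n / 2\<bar>)"
    unfolding X_def by (rule summable_rabs) (simp only: eq geometric)
  also have "\<dots> = d / (2 * (real b - 1))"
    by (simp only: eq geometric)
  finally show "\<bar>X \<xi>\<bar> \<le> d / (2 * (real b - 1))" .
qed

lemma X_case_nat:
  assumes "\<forall>n. \<xi> n \<in> {-1, 1}" and "s \<in> {-1, 1}"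
  shows "X (case_nat s \<xi>) = d * s / (2 * b) + X \<xi> / b"
proof -
  have "\<forall>n. case_nat s \<xi> n \<in> {-1, 1}"
    using assms by (auto split: nat.split)
  from suminf_split_head[OF summable_X[OF this]]
  have "X (case_nat s \<xi>) = (\<Sum>n. d * \<xi> n / real b ^ Suc (Suc n) / 2) + d * s / (2 * b)"
    unfolding X_def by simp
  also have "(\<lambda>n. d * \<xi> n / real b ^ Suc (Suc n) / 2) = (\<lambda>n. d * \<xi> n / real b ^ Suc n / 2 / b)"
    by (simp only: power_Suc divide_divide_eq_left mult_ac)
  also have "(\<Sum>n. d * \<xi> n / real b ^ Suc n / 2 / b) = X \<xi> / b"
    unfolding X_def by (rule suminf_divide[OF summable_X[OF assms(1)]])
  finally show ?thesis by simp
qed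

lemma integrable_coef:
  assumes "integrable signs F"
  shows "integrable signs (\<lambda>\<xi>. F \<xi> * cnj (exponential t (X \<xi>)))"
proof (rule Bochner_Integration.integrable_bound[OF assms])
  show "(\<lambda>\<xi>. F \<xi> * cnj (exponential t (X \<xi>))) \<in> borel_measurable signs"
    using assms[THEN borel_measurable_integrable] unfolding cnj_exponential by measurable
qed (simp add: norm_mult)

text \<open>
  The self-similarity \<open>X (case_nat s \<xi>) = d * s / (2 * b) + X \<xi> / b\<close> on the Fourier side; all exact
  computations of coefficients below are instances of it.
\<close>
lemma coef_first_sign:
  assumes F: "integrable signs F"
  shows "coef F t = (cis (- (pi * d * t / b)) * coef (\<lambda>\<xi>. F (case_nat 1 \<xi>)) (t / b)
                   + cis (pi * d * t / b) * coef (\<lambda>\<xi>. F (case_nat (-1) \<xi>)) (t / b)) / 2"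
proof -
  have half: "(LINT \<xi>|signs. F (case_nat s \<xi>) * cnj (exponential t (X (case_nat s \<xi>)))) =
     cis (- (pi * d * t * s / b)) * coef (\<lambda>\<xi>. F (case_nat s \<xi>)) (t / b)" if s: "s \<in> {-1, 1}" for s
  proof -
    have [measurable]: "(\<lambda>\<xi>. F (case_nat s \<xi>)) \<in> borel_measurable signs"
      using integrable_first_sign[OF F s] by simp
    have e: "exponential t (X (case_nat s \<xi>)) = cis (pi * d * t * s / b) * exponential (t / b) (X \<xi>)"
      if "\<forall>n. \<xi> n \<in> {-1, 1}" for \<xi>
      unfolding X_case_nat[OF that s] exponential_add exponential_scale
      by (simp add: exponential_cis mult_ac)
    have "(LINT \<xi>|signs. F (case_nat s \<xi>) * cnj (exponential t (X (case_nat s \<xi>)))) =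
      (LINT \<xi>|signs. cis (- (pi * d * t * s / b)) * (F (case_nat s \<xi>) * cnj (exponential (t / b) (X \<xi>))))"
    proof (rule integral_cong_AE)
      show "AE \<xi> in signs. F (case_nat s \<xi>) * cnj (exponential t (X (case_nat s \<xi>))) =
        cis (- (pi * d * t * s / b)) * (F (case_nat s \<xi>) * cnj (exponential (t / b) (X \<xi>)))"
        using AE_signs by eventually_elim (simp add: e cis_cnj)
    qed (unfold cnj_exponential, measurable)
    then show ?thesis
      by (simp add: coef_def)
  qed
  show ?thesis
    using half[of 1] half[of "-1"]
    by (subst coef_def, subst integral_first_sign[OF integrable_coef[OF F]])
       (simp add: scaleR_conv_of_real)
qed

text \<open>The two phases average to a cosine for functions of the later signs alone, and to a sine
  for functions with a factor \<open>\<xi> 0\<close>.\<close>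
lemma coef_shift:
  assumes "integrable signs F" "\<And>\<xi>. F (case_nat 1 \<xi>) = G \<xi>" "\<And>\<xi>. F (case_nat (-1) \<xi>) = G \<xi>"
  shows "coef F t = cos (pi * d * t / b) * coef G (t / b)"
proof -
  have "cis (- x) * z + cis x * z = 2 * complex_of_real (cos x) * z" for x z
    by (simp add: complex_eq_iff algebra_simps)
  then show ?thesis
    by (simp add: coef_first_sign[OF assms(1)] assms)
qed

lemma coef_sign:
  assumes "integrable signs F" "\<And>\<xi>. F (case_nat 1 \<xi>) = G \<xi>" "\<And>\<xi>. F (case_nat (-1) \<xi>) = - G \<xi>"
  shows "coef F t = - \<i> * sin (pi * d * t / b) * coef G (t / b)"
proof -
  have "cis (- x) * z - cis x * z = - 2 * \<i> * complex_of_real (sin x) * z" for x z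
    by (simp add: complex_eq_iff algebra_simps)
  moreover have "coef (\<lambda>\<xi>. - G \<xi>) s = - coef G s" for s
    by (simp add: coef_def)
  ultimately show ?thesis
    by (simp add: coef_first_sign[OF assms(1)] assms)
qed

lemma norm_coef_le:
  assumes "integrable signs F" "\<And>\<xi>. cmod (F \<xi>) \<le> 1"
  shows "cmod (coef F t) \<le> 1"
proof -
  have "cmod (coef F t) \<le> (LINT \<xi>|signs. cmod (F \<xi> * cnj (exponential t (X \<xi>))))"
    unfolding coef_def by (rule integral_norm_bound)
  also have "\<dots> \<le> (LINT \<xi>|signs. 1)"
    using integrable_coef[OF assms(1)] assms(2)
    by (intro integral_mono integrable_norm) (auto simp: norm_mult)
  finally show ?thesis using signs_prob.prob_space by simp
qed

lemma
  assumes f: "f \<in> L2_space (bernoulli_convolution b d)"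
  shows L2_inner_eq_coef: "L2_inner (bernoulli_convolution b d) f (exponential t) = coef (\<lambda>\<xi>. f (X \<xi>)) t"
    and L2_norm_eq: "(L2_norm (bernoulli_convolution b d) f)\<^sup>2 = (LINT \<xi>|signs. (cmod (f (X \<xi>)))\<^sup>2)"
    and L2_integrable: "integrable signs (\<lambda>\<xi>. (cmod (f (X \<xi>)))\<^sup>2)"
    and L2_measurable: "f \<in> borel_measurable borel"
proof -
  show f' [measurable]: "f \<in> borel_measurable borel"
    using f by (simp add: L2_space_def distr_X)
  show "L2_inner (bernoulli_convolution b d) f (exponential t) = coef (\<lambda>\<xi>. f (X \<xi>)) t"
    unfolding L2_inner_def distr_X coef_def cnj_exponential by (rule integral_distr[OF X_measurable]) measurable
  show "(L2_norm (bernoulli_convolution b d) f)\<^sup>2 = (LINT \<xi>|signs. (cmod (f (X \<xi>)))\<^sup>2)"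
    unfolding L2_norm_def distr_X by (subst integral_distr) (auto simp: integral_nonneg_AE)
  show "integrable signs (\<lambda>\<xi>. (cmod (f (X \<xi>)))\<^sup>2)"
    using f by (simp add: L2_space_def distr_X integrable_distr_eq)
qed

section \<open>Odd ratio: no frame\<close>

definition angle :: "nat \<Rightarrow> real \<Rightarrow> real" where
  "angle n t = pi * d * t / real b ^ Suc n"

lemma angle_0: "angle 0 t = pi * d * t / b"
  by (simp add: angle_def)

lemma angle_scale: "angle n (t / b) = angle (Suc n) t"
  by (simp add: angle_def)

lemma angle_mult: "angle n t = b * angle (Suc n) t"
  using b_pos by (simp add: angle_def)

lemma angle_tendsto_0: "(\<lambda>n. angle n t) \<longlonglongrightarrow> 0"
proof -
  have "(\<lambda>n. pi * d * t * (1 / real b) ^ Suc n) \<longlonglongrightarrow> pi * d * t * 0"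
    using b_real by (intro tendsto_mult tendsto_const LIMSEQ_Suc LIMSEQ_power_zero) auto
  then show ?thesis
    by (simp add: angle_def power_divide)
qed

text \<open>
  The common factor \<open>u\<close> collects the squared cosines of all angles other than \<open>n\<close> and \<open>Suc n\<close>.
\<close>
lemma sign_coefficients:
  "\<exists>u. 0 \<le> u \<and> u \<le> 1 \<and>
     (cmod (coef (\<lambda>_. 1) t))\<^sup>2 = u * (cos (angle n t))\<^sup>2 * (cos (angle (Suc n) t))\<^sup>2 \<and>
     (cmod (coef (\<lambda>\<xi>. of_real (\<xi> (Suc n))) t))\<^sup>2 =
       u * (cos (angle n t))\<^sup>2 * (sin (angle (Suc n) t))\<^sup>2 \<and>
     (cmod (coef (\<lambda>\<xi>. of_real (\<xi> n * \<xi> (Suc n))) t))\<^sup>2 =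
       u * (sin (angle n t))\<^sup>2 * (sin (angle (Suc n) t))\<^sup>2"
proof (induction n arbitrary: t)
  have int1: "integrable signs (\<lambda>_. 1 :: complex)"
    by simp
  have int: "complex_integrable signs (\<lambda>\<xi>. of_real (\<xi> n))" for n
  proof (rule integrable_signs_bounded[of _ 1])
    fix \<xi> :: "nat \<Rightarrow> real" assume "\<forall>n. \<xi> n \<in> {-1, 1}"
    then show "cmod (of_real (\<xi> n)) \<le> 1" by (simp add: abs_sign)
  qed measurable
  have int2: "complex_integrable signs (\<lambda>\<xi>. of_real (\<xi> n * \<xi> m))" for n m
  proof (rule integrable_signs_bounded[of _ 1])
    fix \<xi> :: "nat \<Rightarrow> real" assume "\<forall>n. \<xi> n \<in> {-1, 1}"
    then show "cmod (of_real (\<xi> n * \<xi> m)) \<le> 1" by (simp add: norm_mult abs_sign)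
  qed measurable
  have one: "coef (\<lambda>_. 1) t = cos (angle 0 t) * coef (\<lambda>_. 1) (t / b)" for t
    unfolding angle_0 by (rule coef_shift[OF int1]) auto
  have first: "coef (\<lambda>\<xi>. of_real (\<xi> 0)) t = - \<i> * sin (angle 0 t) * coef (\<lambda>_. 1) (t / b)" for t
    unfolding angle_0 by (rule coef_sign[OF int]) auto
  have later: "coef (\<lambda>\<xi>. of_real (\<xi> (Suc n))) t =
      cos (angle 0 t) * coef (\<lambda>\<xi>. of_real (\<xi> n)) (t / b)" for n t
    unfolding angle_0 by (rule coef_shift[OF int]) auto
  have later2: "coef (\<lambda>\<xi>. of_real (\<xi> (Suc n) * \<xi> (Suc m))) t =
      cos (angle 0 t) * coef (\<lambda>\<xi>. of_real (\<xi> n * \<xi> m)) (t / b)" for n m t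
    unfolding angle_0 by (rule coef_shift[OF int2]) auto
  have first2: "coef (\<lambda>\<xi>. of_real (\<xi> 0 * \<xi> (Suc n))) t =
      - \<i> * sin (angle 0 t) * coef (\<lambda>\<xi>. of_real (\<xi> n)) (t / b)" for n t
    unfolding angle_0 by (rule coef_sign[OF int2]) auto
  {
    case 0
    have "(cmod (coef (\<lambda>_. 1) (t / b / b)))\<^sup>2 \<le> 1"
      using norm_coef_le[OF int1] by (simp add: power_le_one)
    then show ?case
      by (intro exI[of _ "(cmod (coef (\<lambda>_. 1) (t / b / b)))\<^sup>2"])
         (simp add: one[of t] one[of "t / b"] first later first2 angle_scale norm_mult power_mult_distrib
           del: of_real_mult)
  next
    case (Suc n)
    from Suc.IH[of "t / b"] obtain u where u: "0 \<le> u" "u \<le> 1"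
      "(cmod (coef (\<lambda>_. 1) (t / b)))\<^sup>2 = u * (cos (angle (Suc n) t))\<^sup>2 * (cos (angle (Suc (Suc n)) t))\<^sup>2"
      "(cmod (coef (\<lambda>\<xi>. of_real (\<xi> (Suc n))) (t / b)))\<^sup>2 =
         u * (cos (angle (Suc n) t))\<^sup>2 * (sin (angle (Suc (Suc n)) t))\<^sup>2"
      "(cmod (coef (\<lambda>\<xi>. of_real (\<xi> n * \<xi> (Suc n))) (t / b)))\<^sup>2 =
         u * (sin (angle (Suc n) t))\<^sup>2 * (sin (angle (Suc (Suc n)) t))\<^sup>2"
      unfolding angle_scale by blast
    show ?case
    proof (intro exI[of _ "(cos (angle 0 t))\<^sup>2 * u"] conjI)
      show "(cos (angle 0 t))\<^sup>2 * u \<le> 1"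
        using u(1,2) by (intro mult_le_one) (auto simp: power_le_one abs_square_le_1)
    qed (use u in \<open>auto simp: one[of t] later later2 norm_mult power_mult_distrib simp del: of_real_mult\<close>)
  }
qed

text \<open>
  On the values of \<open>X\<close> this map forgets the first sign. For \<open>b \<ge> 3\<close> the first summand of \<open>X\<close>
  dominates the sum of all others, so the first sign is \<open>sgn X\<close>.
\<close>
definition shift_map :: "real \<Rightarrow> real" where
  "shift_map x = real b * x - d * sgn x / 2"

definition digit :: "nat \<Rightarrow> real \<Rightarrow> real" where
  "digit n x = sgn ((shift_map ^^ n) x)"

lemma digit_measurable [measurable]: "digit n \<in> borel_measurable borel"
proof -
  have [measurable]: "(sgn :: real \<Rightarrow> real) \<in> borel_measurable borel"
    unfolding sgn_if[abs_def] by measurable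
  have [measurable]: "shift_map \<in> borel_measurable borel"
    unfolding shift_map_def[abs_def] by measurable
  have "(shift_map ^^ n) \<in> borel_measurable borel"
    by (induction n) (auto simp: id_def)
  then show ?thesis
    unfolding digit_def[abs_def] by measurable
qed

lemma
  assumes "b \<ge> 3" and \<xi>: "\<forall>n. \<xi> n \<in> {-1, 1}"
  shows sgn_X: "sgn (X \<xi>) = \<xi> 0"
    and shift_map_X: "shift_map (X \<xi>) = X (\<lambda>k. \<xi> (Suc k))"
proof -
  let ?\<eta> = "\<lambda>k. \<xi> (Suc k)"
  have "\<xi> = case_nat (\<xi> 0) ?\<eta>"
    by (auto split: nat.split)
  then have X: "X \<xi> = d * \<xi> 0 / (2 * b) + X ?\<eta> / b"
    using X_case_nat[of ?\<eta> "\<xi> 0"] \<xi> by simp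
  have "\<bar>X ?\<eta>\<bar> \<le> d / (2 * (real b - 1))"
    using \<xi> by (intro abs_X_le) auto
  also have "\<dots> < d / 2"
    using d_pos assms(1) by (intro divide_strict_left_mono) auto
  finally have "\<bar>X ?\<eta> / b\<bar> < d / (2 * b)"
    using b_pos by (simp add: field_simps)
  then have "0 < d / (2 * b) + X ?\<eta> / b" "- (d / (2 * b)) + X ?\<eta> / b < 0"
    by linarith+
  moreover have "\<xi> 0 = 1 \<or> \<xi> 0 = -1"
    using \<xi> by auto
  ultimately show sgn: "sgn (X \<xi>) = \<xi> 0"
    unfolding X by (elim disjE) simp_all
  show "shift_map (X \<xi>) = X ?\<eta>"
    unfolding shift_map_def sgn using b_pos by (simp add: X field_simps)
qed

lemma digit_X:
  assumes "b \<ge> 3" "\<forall>n. \<xi> n \<in> {-1, 1}"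
  shows "digit n (X \<xi>) = \<xi> n"
proof -
  have "(shift_map ^^ n) (X \<xi>) = X (\<lambda>k. \<xi> (k + n))"
    using assms(2) by (induction n) (simp_all add: shift_map_X[OF assms(1)])
  then show ?thesis
    using assms by (simp add: digit_def sgn_X)
qed

text \<open>
  The coefficients of 1 live, up to a small error, on finitely many frequencies. Letting \<open>n\<close> grow
  sends the angles of these frequencies to 0, so that they stop contributing to \<open>\<xi> (Suc n)\<close>, while
  the bounds available for all other frequencies are uniform in \<open>n\<close>.
\<close>
lemma not_admits_fourier_frame_odd:
  assumes "odd b"
  shows "\<not> admits_fourier_frame (bernoulli_convolution b d)"
proof
  let ?\<mu> = "bernoulli_convolution b d"
  define p where "p f t = (cmod (L2_inner ?\<mu> f (exponential t)))\<^sup>2" for f t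
  have b3: "b \<ge> 3"
    using assms b_ge_2 by (cases "b = 2") auto
  define one :: "real \<Rightarrow> complex" where "one = (\<lambda>_. 1)"
  define r where "r n = (\<lambda>x. complex_of_real (digit (Suc n) x))" for n
  define rr where "rr n = (\<lambda>x. complex_of_real (digit n x * digit (Suc n) x))" for n
  have L2: "h \<in> L2_space ?\<mu> \<and> (L2_norm ?\<mu> h)\<^sup>2 = 1 \<and> (\<forall>t. L2_inner ?\<mu> h (exponential t) = coef H t)"
    if [measurable]: "h \<in> borel_measurable borel" "H \<in> borel_measurable signs"
      and h: "\<And>\<xi>. \<forall>n. \<xi> n \<in> {-1, 1} \<Longrightarrow> h (X \<xi>) = H \<xi> \<and> cmod (H \<xi>) = 1" for h H
  proof -
    have int: "integrable signs (\<lambda>\<xi>. (cmod (h (X \<xi>)))\<^sup>2)"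
      by (rule integrable_signs_bounded[of _ 1]) (auto simp: h)
    then have mem: "h \<in> L2_space ?\<mu>"
      by (simp add: L2_space_def distr_X integrable_distr_eq)
    have "(LINT \<xi>|signs. (cmod (h (X \<xi>)))\<^sup>2) = (LINT \<xi>|signs. 1)"
    proof (rule integral_cong_AE)
      show "AE \<xi> in signs. (cmod (h (X \<xi>)))\<^sup>2 = 1"
        using AE_signs by eventually_elim (simp add: h)
    qed measurable
    moreover have "coef (\<lambda>\<xi>. h (X \<xi>)) t = coef H t" for t
      unfolding coef_def
    proof (rule integral_cong_AE)
      show "AE \<xi> in signs. h (X \<xi>) * cnj (exponential t (X \<xi>)) = H \<xi> * cnj (exponential t (X \<xi>))"
        using AE_signs by eventually_elim (simp add: h)
    qed (unfold cnj_exponential, measurable)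
    ultimately show ?thesis
      using mem signs_prob.prob_space by (simp add: L2_norm_eq L2_inner_eq_coef)
  qed
  have one: "one \<in> L2_space ?\<mu> \<and> (L2_norm ?\<mu> one)\<^sup>2 = 1 \<and>
      (\<forall>t. L2_inner ?\<mu> one (exponential t) = coef (\<lambda>_. 1) t)"
    unfolding one_def by (rule L2) auto
  have r: "r n \<in> L2_space ?\<mu> \<and> (L2_norm ?\<mu> (r n))\<^sup>2 = 1 \<and>
      (\<forall>t. L2_inner ?\<mu> (r n) (exponential t) = coef (\<lambda>\<xi>. of_real (\<xi> (Suc n))) t)" for n
    unfolding r_def by (rule L2) (auto simp: digit_X[OF b3] abs_sign)
  have rr: "rr n \<in> L2_space ?\<mu> \<and> (L2_norm ?\<mu> (rr n))\<^sup>2 = 1 \<and>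
      (\<forall>t. L2_inner ?\<mu> (rr n) (exponential t) = coef (\<lambda>\<xi>. of_real (\<xi> n * \<xi> (Suc n))) t)" for n
    unfolding rr_def by (rule L2) (auto simp: digit_X[OF b3] abs_sign norm_mult)

  assume "admits_fourier_frame ?\<mu>"
  then obtain L A C where A: "0 < A" "A \<le> C" and
    frame: "\<And>f. f \<in> L2_space ?\<mu> \<Longrightarrow> p f summable_on L \<and>
      A * (L2_norm ?\<mu> f)\<^sup>2 \<le> infsum (p f) L \<and> infsum (p f) L \<le> C * (L2_norm ?\<mu> f)\<^sup>2"
    unfolding admits_fourier_frame_def fourier_frame_spectrum_def p_def by blast
  \<comment> \<open>\<open>K\<close> is chosen so that the term with \<open>\<kappa>\<close> in the transfer inequality costs at most a quarter
    of \<open>A\<close>; the finite set and the index below are chosen to lose two more quarters.\<close>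
  define B where "B = (real b)\<^sup>2"
  define K where "K = B + 4 * B * C / A"
  have B: "B \<ge> 1"
    unfolding B_def using b_real by (intro one_le_power) auto
  have K: "K > 0" "B \<le> K"
    unfolding K_def using A B by (auto intro!: add_pos_nonneg)
  define \<kappa> where "\<kappa> = B / (K + 1 - B)"
  have kappa: "0 \<le> \<kappa>" "\<kappa> * C \<le> A / 4"
  proof -
    show "0 \<le> \<kappa>" using B K by (simp add: \<kappa>_def)
    have "0 < A + 4 * B * C"
      using A B by (intro add_pos_pos mult_pos_pos) auto
    then show "\<kappa> * C \<le> A / 4"
      using A B by (simp add: \<kappa>_def K_def field_simps)
  qed

  have transfer: "p (r n) t \<le> K * p one t + \<kappa> * p (rr n) t"
    and small: "p (r n) t \<le> (sin (angle (Suc n) t))\<^sup>2" for n t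
  proof -
    from sign_coefficients[of t n] obtain u where u: "0 \<le> u" "u \<le> 1"
      "p one t = u * (cos (angle n t))\<^sup>2 * (cos (angle (Suc n) t))\<^sup>2"
      "p (r n) t = u * (cos (angle n t))\<^sup>2 * (sin (angle (Suc n) t))\<^sup>2"
      "p (rr n) t = u * (sin (angle n t))\<^sup>2 * (sin (angle (Suc n) t))\<^sup>2"
      using one r[of n] rr[of n] unfolding p_def by auto
    have "\<bar>cos (angle n t)\<bar> \<le> b * \<bar>cos (angle (Suc n) t)\<bar>"
      unfolding angle_mult[of n] by (rule abs_cos_odd_multiple_le[OF assms])
    then have "\<bar>cos (angle n t)\<bar>\<^sup>2 \<le> (b * \<bar>cos (angle (Suc n) t)\<bar>)\<^sup>2"
      by (rule power_mono) simp
    then have "(cos (angle n t))\<^sup>2 \<le> B * (cos (angle (Suc n) t))\<^sup>2"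
      by (simp add: B_def power_mult_distrib)
    then show "p (r n) t \<le> K * p one t + \<kappa> * p (rr n) t"
      unfolding u(3-5) \<kappa>_def using u(1) B K by (intro transfer_inequality) auto
    have "u * (cos (angle n t))\<^sup>2 \<le> 1"
      using u(1,2) by (intro mult_le_one) (auto simp: abs_square_le_1)
    from mult_right_mono[OF this] show "p (r n) t \<le> (sin (angle (Suc n) t))\<^sup>2"
      unfolding u(4) by simp
  qed

  from frame[of one] one have "p one summable_on L"
    by blast
  then obtain F where F: "finite F" "F \<subseteq> L" "infsum (p one) (L - F) < A / (4 * K)"
    by (rule sum_off_finite_set_small[of _ _ "A / (4 * K)"]) (use A K in auto)
  have "(\<lambda>n. \<Sum>t\<in>F. (sin (angle (Suc n) t))\<^sup>2) \<longlonglongrightarrow> (\<Sum>t\<in>F. (sin 0)\<^sup>2)"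
    by (intro tendsto_sum tendsto_power tendsto_sin LIMSEQ_Suc angle_tendsto_0)
  then have "eventually (\<lambda>n. (\<Sum>t\<in>F. (sin (angle (Suc n) t))\<^sup>2) < A / 4) sequentially"
    by (rule order_tendstoD) (use A in auto)
  then obtain n where n: "(\<Sum>t\<in>F. (sin (angle (Suc n) t))\<^sup>2) < A / 4"
    unfolding eventually_sequentially by blast

  have sub: "p f summable_on L - F" if "f \<in> L2_space ?\<mu>" for f
    using frame[OF that] summable_on_subset_banach[of "p f" L "L - F"] by blast
  have tail: "infsum (p (r n)) (L - F) \<le> A / 4 + A / 4"
  proof -
    have "infsum (p (r n)) (L - F) \<le>
        infsum (\<lambda>t. K * p one t + \<kappa> * p (rr n) t) (L - F)"
      using sub[of one] sub[of "r n"] sub[of "rr n"] one r[of n] rr[of n]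
      by (intro infsum_mono transfer summable_on_add summable_on_cmult_right) auto
    also have "\<dots> = K * infsum (p one) (L - F) + \<kappa> * infsum (p (rr n)) (L - F)"
      using sub[of one] sub[of "rr n"] one rr[of n]
      by (subst infsum_add) (auto intro!: summable_on_cmult_right simp: infsum_cmult_right)
    also have "\<dots> \<le> A / 4 + \<kappa> * C"
    proof (intro add_mono mult_left_mono)
      show "K * infsum (p one) (L - F) \<le> A / 4"
        using F(3) K by (simp add: field_simps)
      have "infsum (p (rr n)) (L - F) \<le> infsum (p (rr n)) L"
        using frame[of "rr n"] sub[of "rr n"] rr[of n] by (intro infsum_mono_neutral) (auto simp: p_def)
      also have "\<dots> \<le> C"
        using frame[of "rr n"] rr[of n] by simp
      finally show "infsum (p (rr n)) (L - F) \<le> C" .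
    qed (use kappa K in auto)
    also note kappa(2)
    finally show ?thesis by simp
  qed
  have "infsum (p (r n)) (L - F) = infsum (p (r n)) L - sum (p (r n)) F"
    using frame[of "r n"] r[of n] F(1,2) by (subst infsum_Diff) auto
  moreover have "sum (p (r n)) F < A / 4"
    using sum_mono[of F "p (r n)"] small n by (meson le_less_trans)
  moreover have "A \<le> infsum (p (r n)) L"
    using frame[of "r n"] r[of n] by simp
  ultimately show False
    using tail A by linarith
qed

section \<open>Square-integrable functions of the signs\<close>

definition sq_norm :: "((nat \<Rightarrow> real) \<Rightarrow> complex) \<Rightarrow> real" where
  "sq_norm F = (LINT \<xi>|signs. (cmod (F \<xi>))\<^sup>2)"

definition sq_integrable :: "((nat \<Rightarrow> real) \<Rightarrow> complex) \<Rightarrow> bool" where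
  "sq_integrable F \<longleftrightarrow> F \<in> borel_measurable signs \<and> integrable signs (\<lambda>\<xi>. (cmod (F \<xi>))\<^sup>2)"

definition depends_on_first :: "nat \<Rightarrow> ((nat \<Rightarrow> real) \<Rightarrow> complex) \<Rightarrow> bool" where
  "depends_on_first n F \<longleftrightarrow> (\<forall>\<xi> \<eta>. (\<forall>i<n. \<xi> i = \<eta> i) \<longrightarrow> F \<xi> = F \<eta>)"

lemma sq_integrable_imp_integrable: "sq_integrable F \<Longrightarrow> integrable signs F"
proof -
  assume F: "sq_integrable F"
  have "cmod (F \<xi>) \<le> 1 + (cmod (F \<xi>))\<^sup>2" for \<xi>
    using zero_le_power2[of "cmod (F \<xi>) - 1"] norm_ge_zero[of "F \<xi>"]
    by (simp add: power2_eq_square algebra_simps del: norm_ge_zero)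
  then show ?thesis
    using F unfolding sq_integrable_def
    by (intro Bochner_Integration.integrable_bound[of signs "\<lambda>\<xi>. 1 + (cmod (F \<xi>))\<^sup>2" F]) auto
qed

lemma sq_integrable_cmult: "sq_integrable F \<Longrightarrow> sq_integrable (\<lambda>\<xi>. c * F \<xi>)"
  by (auto simp: sq_integrable_def norm_mult power_mult_distrib)

lemma sq_norm_cmult: "sq_norm (\<lambda>\<xi>. c * F \<xi>) = (cmod c)\<^sup>2 * sq_norm F"
  by (simp add: sq_norm_def norm_mult power_mult_distrib)

lemma sq_integrable_add:
  assumes "sq_integrable F" "sq_integrable G"
  shows "sq_integrable (\<lambda>\<xi>. F \<xi> + G \<xi>)"
proof -
  have [measurable]: "F \<in> borel_measurable signs" "G \<in> borel_measurable signs"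
    using assms by (auto simp: sq_integrable_def)
  have "integrable signs (\<lambda>\<xi>. (cmod (F \<xi> + G \<xi>))\<^sup>2)"
    by (rule Bochner_Integration.integrable_bound[of signs "\<lambda>\<xi>. 2 * (cmod (F \<xi>))\<^sup>2 + 2 * (cmod (G \<xi>))\<^sup>2"])
       (use assms norm_add_sq_le in \<open>auto simp: sq_integrable_def\<close>)
  then show ?thesis by (simp add: sq_integrable_def)
qed

lemma sq_norm_add_le:
  assumes "sq_integrable F" "sq_integrable G"
  shows "sq_norm (\<lambda>\<xi>. F \<xi> + G \<xi>) \<le> 2 * sq_norm F + 2 * sq_norm G"
proof -
  have "sq_norm (\<lambda>\<xi>. F \<xi> + G \<xi>) \<le> (LINT \<xi>|signs. 2 * (cmod (F \<xi>))\<^sup>2 + 2 * (cmod (G \<xi>))\<^sup>2)"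
    unfolding sq_norm_def using assms sq_integrable_add[OF assms] norm_add_sq_le
    by (intro integral_mono) (auto simp: sq_integrable_def)
  also have "\<dots> = 2 * sq_norm F + 2 * sq_norm G"
    using assms by (simp add: sq_norm_def sq_integrable_def)
  finally show ?thesis .
qed

lemma coef_linear:
  assumes "sq_integrable F" "sq_integrable G"
  shows "coef (\<lambda>\<xi>. p * F \<xi> + q * G \<xi>) t = p * coef F t + q * coef G t"
proof -
  have "coef (\<lambda>\<xi>. p * F \<xi> + q * G \<xi>) t =
      (LINT \<xi>|signs. p * (F \<xi> * cnj (exponential t (X \<xi>))) + q * (G \<xi> * cnj (exponential t (X \<xi>))))"
    by (simp add: coef_def algebra_simps)
  also have "\<dots> = p * coef F t + q * coef G t"
    unfolding coef_def using integrable_coef[OF sq_integrable_imp_integrable] assms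
    by (subst Bochner_Integration.integral_add) auto
  finally show ?thesis .
qed

lemma norm_coef_sq_le:
  assumes "sq_integrable F"
  shows "(cmod (coef F t))\<^sup>2 \<le> sq_norm F"
proof -
  note F = assms[THEN sq_integrable_imp_integrable]
  let ?c = "LINT \<xi>|signs. cmod (F \<xi>)"
  have "cmod (coef F t) \<le> ?c"
    unfolding coef_def using integral_norm_bound[of signs "\<lambda>\<xi>. F \<xi> * cnj (exponential t (X \<xi>))"]
    by (simp add: norm_mult)
  then have "(cmod (coef F t))\<^sup>2 \<le> ?c\<^sup>2"
    by (rule power_mono) simp
  also have "\<dots> \<le> sq_norm F"
    using signs_prob.variance_positive[of "\<lambda>\<xi>. cmod (F \<xi>)"] F assms
    by (subst (asm) signs_prob.variance_eq) (auto simp: sq_norm_def sq_integrable_def)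
  finally show ?thesis .
qed

lemma sq_integrable_first_sign:
  assumes "sq_integrable F" "s \<in> {-1, 1}"
  shows "sq_integrable (\<lambda>\<xi>. F (case_nat s \<xi>))"
  using assms integrable_first_sign[of "\<lambda>\<xi>. (cmod (F \<xi>))\<^sup>2" s]
    measurable_compose[OF measurable_case_nat_signs, of F borel s]
  by (auto simp: sq_integrable_def)

lemma sq_norm_first_sign:
  assumes "sq_integrable F"
  shows "sq_norm F = (sq_norm (\<lambda>\<xi>. F (case_nat 1 \<xi>)) + sq_norm (\<lambda>\<xi>. F (case_nat (-1) \<xi>))) / 2"
  unfolding sq_norm_def using assms
  by (subst integral_first_sign) (auto simp: sq_integrable_def)

section \<open>Approximation by functions of finitely many signs\<close>

definition approximable :: "((nat \<Rightarrow> real) \<Rightarrow> complex) \<Rightarrow> bool" where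
  "approximable F \<longleftrightarrow> sq_integrable F \<and> (\<forall>\<epsilon>>0. \<exists>n G. sq_integrable G \<and> depends_on_first n G \<and>
     sq_norm (\<lambda>\<xi>. F \<xi> - G \<xi>) < \<epsilon>)"

lemma depends_on_first_mono: "depends_on_first n F \<Longrightarrow> n \<le> m \<Longrightarrow> depends_on_first m F"
  by (auto simp: depends_on_first_def)

lemma sq_integrable_diff: "sq_integrable F \<Longrightarrow> sq_integrable G \<Longrightarrow> sq_integrable (\<lambda>\<xi>. F \<xi> - G \<xi>)"
  using sq_integrable_add[OF _ sq_integrable_cmult[of G "-1"]] by simp

lemma approximable_self: "sq_integrable F \<Longrightarrow> depends_on_first n F \<Longrightarrow> approximable F"
  unfolding approximable_def by (auto simp: sq_norm_def intro!: exI[of _ n] exI[of _ F])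

lemma approximable_add:
  assumes "approximable F" "approximable G"
  shows "approximable (\<lambda>\<xi>. F \<xi> + G \<xi>)"
  unfolding approximable_def
proof (intro conjI allI impI)
  show "sq_integrable (\<lambda>\<xi>. F \<xi> + G \<xi>)"
    using assms by (simp add: approximable_def sq_integrable_add)
  fix \<epsilon> :: real assume "\<epsilon> > 0"
  then have "\<epsilon> / 4 > 0" by simp
  with assms obtain n F' m G' where F': "sq_integrable F'" "depends_on_first n F'" "sq_norm (\<lambda>\<xi>. F \<xi> - F' \<xi>) < \<epsilon> / 4"
    and G': "sq_integrable G'" "depends_on_first m G'" "sq_norm (\<lambda>\<xi>. G \<xi> - G' \<xi>) < \<epsilon> / 4"
    unfolding approximable_def by metis
  have "sq_norm (\<lambda>\<xi>. (F \<xi> - F' \<xi>) + (G \<xi> - G' \<xi>)) \<le> 2 * sq_norm (\<lambda>\<xi>. F \<xi> - F' \<xi>) + 2 * sq_norm (\<lambda>\<xi>. G \<xi> - G' \<xi>)"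
    using assms F' G' by (intro sq_norm_add_le sq_integrable_diff) (auto simp: approximable_def)
  also have "\<dots> < \<epsilon>"
    using F' G' by simp
  finally have "sq_norm (\<lambda>\<xi>. (F \<xi> + G \<xi>) - (F' \<xi> + G' \<xi>)) < \<epsilon>"
    by (simp add: algebra_simps)
  moreover have "depends_on_first (max n m) (\<lambda>\<xi>. F' \<xi> + G' \<xi>)"
    using F'(2) G'(2) unfolding depends_on_first_def by (metis less_max_iff_disj)
  ultimately show "\<exists>n H. sq_integrable H \<and> depends_on_first n H \<and> sq_norm (\<lambda>\<xi>. F \<xi> + G \<xi> - H \<xi>) < \<epsilon>"
    using sq_integrable_add[OF F'(1) G'(1)] by blast
qed

lemma approximable_limit:
  assumes F: "sq_integrable F" and G: "\<And>k::nat. approximable (G k)"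
    and lim: "\<And>\<xi>. (\<lambda>k. G k \<xi>) \<longlonglongrightarrow> F \<xi>"
    and w: "integrable signs w" "\<And>k \<xi>. (cmod (F \<xi> - G k \<xi>))\<^sup>2 \<le> w \<xi>"
  shows "approximable F"
  unfolding approximable_def
proof (intro conjI allI impI F)
  fix \<epsilon> :: real assume \<epsilon>: "\<epsilon> > 0"
  have [measurable]: "F \<in> borel_measurable signs" "G k \<in> borel_measurable signs" for k
    using F G by (auto simp: approximable_def sq_integrable_def)
  have "(\<lambda>k. sq_norm (\<lambda>\<xi>. F \<xi> - G k \<xi>)) \<longlonglongrightarrow> (LINT \<xi>|signs. 0)"
    unfolding sq_norm_def
  proof (rule integral_dominated_convergence[where w = w])
    show "AE \<xi> in signs. (\<lambda>k. (cmod (F \<xi> - G k \<xi>))\<^sup>2) \<longlonglongrightarrow> 0"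
    proof (rule AE_I2)
      fix \<xi>
      have "(\<lambda>k. (cmod (F \<xi> - G k \<xi>))\<^sup>2) \<longlonglongrightarrow> (cmod (F \<xi> - F \<xi>))\<^sup>2"
        by (intro tendsto_power tendsto_norm tendsto_diff tendsto_const lim)
      then show "(\<lambda>k. (cmod (F \<xi> - G k \<xi>))\<^sup>2) \<longlonglongrightarrow> 0" by simp
    qed
  qed (use w in auto)
  then have "eventually (\<lambda>k. sq_norm (\<lambda>\<xi>. F \<xi> - G k \<xi>) < \<epsilon> / 4) sequentially"
    by (rule order_tendstoD) (use \<epsilon> in auto)
  then obtain k where k: "sq_norm (\<lambda>\<xi>. F \<xi> - G k \<xi>) < \<epsilon> / 4"
    unfolding eventually_sequentially by blast
  from \<epsilon> have "\<epsilon> / 4 > 0" by simp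
  with G[of k] obtain n H where H: "sq_integrable H" "depends_on_first n H" "sq_norm (\<lambda>\<xi>. G k \<xi> - H \<xi>) < \<epsilon> / 4"
    unfolding approximable_def by metis
  have "sq_norm (\<lambda>\<xi>. (F \<xi> - G k \<xi>) + (G k \<xi> - H \<xi>)) \<le>
      2 * sq_norm (\<lambda>\<xi>. F \<xi> - G k \<xi>) + 2 * sq_norm (\<lambda>\<xi>. G k \<xi> - H \<xi>)"
    using F G[of k] H by (intro sq_norm_add_le sq_integrable_diff) (auto simp: approximable_def)
  also have "\<dots> < \<epsilon>"
    using k H by simp
  finally show "\<exists>n H. sq_integrable H \<and> depends_on_first n H \<and> sq_norm (\<lambda>\<xi>. F \<xi> - H \<xi>) < \<epsilon>"
    using H by auto
qed

lemma approximable_cmult: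
  assumes "approximable F"
  shows "approximable (\<lambda>\<xi>. c * F \<xi>)"
  unfolding approximable_def
proof (intro conjI allI impI)
  show "sq_integrable (\<lambda>\<xi>. c * F \<xi>)"
    using assms by (simp add: approximable_def sq_integrable_cmult)
  fix \<epsilon> :: real assume "\<epsilon> > 0"
  then have "\<epsilon> / ((cmod c)\<^sup>2 + 1) > 0" by (simp add: add_nonneg_pos)
  with assms obtain n G where G: "sq_integrable G" "depends_on_first n G"
    "sq_norm (\<lambda>\<xi>. F \<xi> - G \<xi>) < \<epsilon> / ((cmod c)\<^sup>2 + 1)"
    unfolding approximable_def by metis
  have pos: "(cmod c)\<^sup>2 + 1 > 0" by (simp add: add_nonneg_pos)
  have "sq_norm (\<lambda>\<xi>. c * F \<xi> - c * G \<xi>) = (cmod c)\<^sup>2 * sq_norm (\<lambda>\<xi>. F \<xi> - G \<xi>)"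
    by (simp add: sq_norm_cmult[symmetric] right_diff_distrib)
  also have "\<dots> \<le> ((cmod c)\<^sup>2 + 1) * sq_norm (\<lambda>\<xi>. F \<xi> - G \<xi>)"
    by (intro mult_right_mono) (auto simp: sq_norm_def)
  also have "\<dots> < \<epsilon>"
    using G(3) pos by (simp add: field_simps)
  finally show "\<exists>n H. sq_integrable H \<and> depends_on_first n H \<and> sq_norm (\<lambda>\<xi>. c * F \<xi> - H \<xi>) < \<epsilon>"
    using G sq_integrable_cmult[OF G(1), of c]
    by (intro exI[of _ n] exI[of _ "\<lambda>\<xi>. c * G \<xi>"]) (auto simp: depends_on_first_def)
qed

lemma approximable_sum:
  "finite I \<Longrightarrow> (\<And>i. i \<in> I \<Longrightarrow> approximable (F i)) \<Longrightarrow> approximable (\<lambda>\<xi>. \<Sum>i\<in>I. F i \<xi>)"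
proof (induction I rule: finite_induct)
  case empty
  show ?case
    by (rule approximable_self[of _ 0]) (auto simp: sq_integrable_def depends_on_first_def)
qed (auto intro: approximable_add)

lemma sq_integrable_indicator:
  assumes [measurable]: "A \<in> sets signs"
  shows "sq_integrable (indicator A)"
proof -
  have "integrable signs (\<lambda>\<xi>. (cmod (indicator A \<xi>))\<^sup>2)"
  proof (rule integrable_signs_bounded)
    show "norm ((cmod (indicator A \<xi>))\<^sup>2) \<le> 1" for \<xi>
      by (simp split: split_indicator)
  qed measurable
  then show ?thesis by (simp add: sq_integrable_def)
qed

text \<open>
  Cylinder sets form an intersection-stable generator, and approximability passes to complements
  and countable disjoint unions.
\<close>
lemma approximable_indicator:
  assumes "A \<in> sets signs"
  shows "approximable (indicator A)"
proof -
  let ?M = "\<lambda>_::nat. measure_pmf (pmf_of_set {-1, 1 :: real})"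
  let ?S = "\<Pi>\<^sub>E n\<in>(UNIV :: nat set). space (?M n)"
  have sets: "sets signs = sigma_sets ?S (prod_algebra UNIV ?M)"
    unfolding signs_def by (rule sets_PiM)
  have "prod_algebra UNIV ?M \<subseteq> Pow ?S"
    by (rule prod_algebra_sets_into_space)
  with Int_stable_prod_algebra show ?thesis
    using assms unfolding sets
  proof (induction rule: sigma_sets_induct_disjoint)
    case (basic A)
    then have A: "A \<in> sets signs"
      unfolding sets by (rule sigma_sets.Basic)
    from basic obtain J E where J: "A = prod_emb UNIV ?M J (\<Pi>\<^sub>E j\<in>J. E j)" "finite J"
      by (rule prod_algebraE)
    then obtain n where n: "J \<subseteq> {..<n}"
      using finite_nat_iff_bounded by auto
    have "depends_on_first n (indicator A)"
      unfolding depends_on_first_def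
    proof (intro allI impI)
      fix \<xi> \<eta> :: "nat \<Rightarrow> real" assume "\<forall>i<n. \<xi> i = \<eta> i"
      then have "restrict \<xi> J = restrict \<eta> J"
        using n by (auto simp: restrict_def fun_eq_iff)
      then show "(indicator A \<xi> :: complex) = indicator A \<eta>"
        unfolding J(1) by (simp add: prod_emb_def indicator_def)
    qed
    then show ?case
      using sq_integrable_indicator[OF A] by (rule approximable_self[rotated])
  next
    case empty
    show ?case
      by (rule approximable_self[of _ 0]) (auto simp: sq_integrable_def depends_on_first_def)
  next
    case (compl A)
    have "approximable (\<lambda>_. 1)"
      by (rule approximable_self[of _ 0]) (auto simp: sq_integrable_def depends_on_first_def)
    from approximable_add[OF this approximable_cmult[OF compl.IH, of "-1"]]
    have "approximable (\<lambda>\<xi>. 1 + - 1 * indicator A \<xi>)" .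
    also have "(\<lambda>\<xi>. 1 + - 1 * indicator A \<xi> :: complex) = indicator (?S - A)"
      by (auto simp: fun_eq_iff split: split_indicator)
    finally show ?case .
  next
    case (union A)
    have [measurable]: "A i \<in> sets signs" for i
      using union.hyps(2) unfolding sets by auto
    show ?case
    proof (rule approximable_limit[where w = "\<lambda>_. 1"])
      show "sq_integrable (indicator (\<Union>i. A i))"
        by (rule sq_integrable_indicator) measurable
      show "approximable (\<lambda>\<xi>. \<Sum>i<k. indicator (A i) \<xi>)" for k
        by (intro approximable_sum union.IH) auto
      fix \<xi>
      have part: "(\<Sum>i<k. indicator (A i) \<xi> :: complex) = indicator (\<Union>i<k. A i) \<xi>" for k
        using union.hyps(1) by (intro indicator_UN_disjoint[symmetric]) (auto simp: disjoint_family_on_def)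
      show "(\<lambda>k. \<Sum>i<k. indicator (A i) \<xi> :: complex) \<longlonglongrightarrow> indicator (\<Union>i. A i) \<xi>"
        unfolding part by (rule LIMSEQ_indicator_UN)
      show "(cmod (indicator (\<Union>i. A i) \<xi> - (\<Sum>i<k. indicator (A i) \<xi>)))\<^sup>2 \<le> 1" for k
        unfolding part by (auto split: split_indicator)
    qed simp
  qed
qed

text \<open>
  Simple functions can be chosen to converge pointwise with modulus at most \<open>2 * \<bar>F\<bar>\<close>, which provides
  the dominating function for convergence in \<open>L\<^sup>2\<close>.
\<close>
lemma approximable_sq_integrable:
  assumes F: "sq_integrable F"
  shows "approximable F"
proof -
  have meas: "F \<in> borel_measurable signs"
    using F by (simp add: sq_integrable_def)
  from borel_measurable_implies_sequence_metric[OF this, of 0]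
  obtain G where G: "\<And>k. simple_function signs (G k)" "\<And>\<xi>. (\<lambda>k. G k \<xi>) \<longlonglongrightarrow> F \<xi>"
    "\<And>k \<xi>. cmod (G k \<xi>) \<le> 2 * cmod (F \<xi>)"
    by auto
  show ?thesis
  proof (rule approximable_limit[OF F _ G(2)])
    fix k
    have fin: "finite (range (G k))"
      using G(1)[of k] by (simp add: simple_function_def)
    have "(\<Sum>y\<in>range (G k). y * indicator (G k -` {y}) \<xi>) =
        (\<Sum>y\<in>range (G k). if G k \<xi> = y then y else 0)" for \<xi>
      by (intro sum.cong) (auto split: split_indicator)
    then have "G k = (\<lambda>\<xi>. \<Sum>y\<in>range (G k). y * indicator (G k -` {y}) \<xi>)"
      using fin by (simp add: fun_eq_iff sum.delta)
    moreover have "approximable (\<lambda>\<xi>. \<Sum>y\<in>range (G k). y * indicator (G k -` {y}) \<xi>)"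
      using G(1)[of k] unfolding simple_function_def
      by (intro approximable_sum approximable_cmult approximable_indicator) auto
    ultimately show "approximable (G k)" by simp
  next
    show "integrable signs (\<lambda>\<xi>. 9 * (cmod (F \<xi>))\<^sup>2)"
      using F by (simp add: sq_integrable_def)
    fix k \<xi>
    have "cmod (F \<xi> - G k \<xi>) \<le> 3 * cmod (F \<xi>)"
      using norm_triangle_ineq4[of "F \<xi>" "G k \<xi>"] G(3)[of k \<xi>] by linarith
    then have "(cmod (F \<xi> - G k \<xi>))\<^sup>2 \<le> (3 * cmod (F \<xi>))\<^sup>2"
      by (rule power_mono) simp
    then show "(cmod (F \<xi> - G k \<xi>))\<^sup>2 \<le> 9 * (cmod (F \<xi>))\<^sup>2"
      by (simp add: power_mult_distrib)
  qed
qed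

section \<open>Even ratio: frequencies\<close>

text \<open>
  The integers \<open>\<sigma> * (\<Sum>k<n. a k * (- b) ^ k)\<close> with digits \<open>a k \<in> {0, 1}\<close>. For \<open>b = 2\<close> the
  digits without alternating signs would miss the negative integers; in base \<open>- 2\<close> every integer is
  represented.
\<close>
fun freqs :: "int \<Rightarrow> nat \<Rightarrow> int set" where
  "freqs \<sigma> 0 = {0}"
| "freqs \<sigma> (Suc n) = (\<lambda>m. int b * m) ` freqs (-\<sigma>) n \<union> (\<lambda>m. int b * m + \<sigma>) ` freqs (-\<sigma>) n"

lemma finite_freqs [simp]: "finite (freqs \<sigma> n)"
  by (induction n arbitrary: \<sigma>) auto

lemma zero_in_freqs: "0 \<in> freqs \<sigma> n"
  by (induction n arbitrary: \<sigma>) force+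

lemma freqs_mono: "n \<le> m \<Longrightarrow> freqs \<sigma> n \<subseteq> freqs \<sigma> m"
proof (rule lift_Suc_mono_le[of "freqs \<sigma>"])
  show "freqs \<sigma> n \<subseteq> freqs \<sigma> (Suc n)" for n
  proof (induction n arbitrary: \<sigma>)
    case 0
    show ?case using zero_in_freqs[of \<sigma> 1] by simp
  next
    case (Suc n)
    show ?case
      using Suc.IH[of "-\<sigma>"] by (subst (1 2) freqs.simps(2)) blast
  qed
qed

lemma sum_freqs_Suc:
  assumes "\<sigma> \<in> {-1, 1}"
  shows "sum f (freqs \<sigma> (Suc n)) =
    (\<Sum>m\<in>freqs (-\<sigma>) n. f (int b * m)) + (\<Sum>m\<in>freqs (-\<sigma>) n. f (int b * m + \<sigma>))"
proof -
  have "int b * m \<noteq> int b * k + \<sigma>" for m k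
  proof
    assume "int b * m = int b * k + \<sigma>"
    then have "\<sigma> = int b * (m - k)" by (simp add: algebra_simps)
    then have "int b dvd \<sigma>" by (rule dvdI)
    with assms b_ge_2 show False by auto
  qed
  then have disj: "(\<lambda>m. int b * m) ` freqs (-\<sigma>) n \<inter> (\<lambda>m. int b * m + \<sigma>) ` freqs (-\<sigma>) n = {}"
    by auto
  have inj: "inj_on (\<lambda>m. int b * m) A" "inj_on (\<lambda>m. int b * m + \<sigma>) A" for A
    using b_ge_2 by (auto simp: inj_on_def)
  show ?thesis
    by (simp add: sum.union_disjoint disj sum.reindex inj)
qed

text \<open>
  Each bound feeds the induction step of the other, with \<open>\<sigma>\<close> replaced by \<open>- \<sigma>\<close>; the different
  subtracted constants are what makes both steps close.
\<close>
lemma freqs_bound: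
  assumes "\<sigma> \<in> {-1, 1}" "m \<in> freqs \<sigma> n"
  shows "((int b)\<^sup>2 - 1) * (\<sigma> * m) \<le> int b ^ Suc n - 1"
    and "((int b)\<^sup>2 - 1) * (- \<sigma> * m) \<le> int b ^ Suc n - b"
proof -
  have "((int b)\<^sup>2 - 1) * (\<sigma> * m) \<le> int b ^ Suc n - 1 \<and>
      ((int b)\<^sup>2 - 1) * (- \<sigma> * m) \<le> int b ^ Suc n - b"
    using assms
  proof (induction n arbitrary: \<sigma> m)
    case 0
    then show ?case using b_ge_2 by auto
  next
    case (Suc n)
    then obtain k a where k: "k \<in> freqs (-\<sigma>) n" "m = int b * k + a * \<sigma>" "a \<in> {0, 1}"
      by auto
    have sq: "\<sigma> * \<sigma> = 1" using Suc.prems by auto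
    have IH: "((int b)\<^sup>2 - 1) * (- \<sigma> * k) \<le> int b ^ Suc n - 1"
      "((int b)\<^sup>2 - 1) * (\<sigma> * k) \<le> int b ^ Suc n - b"
      using Suc.IH[of "-\<sigma>" k] Suc.prems k by auto
    have B: "(int b)\<^sup>2 - 1 \<ge> 0" using b_ge_2 by (simp add: power2_eq_square mult_le_cancel_left)
    have "\<sigma> * m = b * (\<sigma> * k) + a * (\<sigma> * \<sigma>)"
      unfolding k(2) by (simp only: distrib_left mult_ac)
    then have \<sigma>m: "\<sigma> * m = b * (\<sigma> * k) + a"
      unfolding sq by simp
    have "((int b)\<^sup>2 - 1) * (\<sigma> * m) = b * (((int b)\<^sup>2 - 1) * (\<sigma> * k)) + ((int b)\<^sup>2 - 1) * a"
      unfolding \<sigma>m by (simp add: algebra_simps)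
    also have "\<dots> \<le> b * (int b ^ Suc n - b) + ((int b)\<^sup>2 - 1) * 1"
      using IH B k(3) by (intro add_mono mult_left_mono) auto
    finally have 1: "((int b)\<^sup>2 - 1) * (\<sigma> * m) \<le> int b ^ Suc (Suc n) - 1"
      by (simp add: algebra_simps power2_eq_square)
    have "((int b)\<^sup>2 - 1) * (- \<sigma> * m) = b * (((int b)\<^sup>2 - 1) * (- \<sigma> * k)) - ((int b)\<^sup>2 - 1) * a"
      using \<sigma>m by (simp add: algebra_simps)
    also have "\<dots> \<le> b * (int b ^ Suc n - 1) - 0"
      using IH B k(3) by (intro diff_mono mult_left_mono) auto
    finally have "((int b)\<^sup>2 - 1) * (- \<sigma> * m) \<le> int b ^ Suc (Suc n) - b"
      by (simp add: algebra_simps)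
    with 1 show ?case ..
  qed
  then show "((int b)\<^sup>2 - 1) * (\<sigma> * m) \<le> int b ^ Suc n - 1"
    and "((int b)\<^sup>2 - 1) * (- \<sigma> * m) \<le> int b ^ Suc n - b"
    by auto
qed

definition freq :: "int \<Rightarrow> real" where
  "freq m = real b * real_of_int m / (2 * d)"

text \<open>
  The constant is below \<open>b / 2\<close>, the position of the first zero of the coefficients of the constant
  1 (after scaling by \<open>d\<close>), for every \<open>b \<ge> 2\<close>.
\<close>
lemma abs_freq_le:
  assumes "\<sigma> \<in> {-1, 1}" "m \<in> freqs \<sigma> n"
  shows "d * \<bar>freq m / b ^ n\<bar> \<le> 2 / 3"
proof -
  have "((int b)\<^sup>2 - 1) * \<bar>m\<bar> \<le> int b ^ Suc n"
    using freqs_bound[OF assms] assms(1) b_ge_2 by (auto simp: abs_if)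
  then have "real_of_int (((int b)\<^sup>2 - 1) * \<bar>m\<bar>) \<le> real_of_int (int b ^ Suc n)"
    by (simp only: of_int_le_iff)
  then have "((real b)\<^sup>2 - 1) * \<bar>real_of_int m\<bar> \<le> real b * real b ^ n"
    by simp
  moreover have "3 * (real b)\<^sup>2 \<le> 4 * ((real b)\<^sup>2 - 1)"
    using mult_mono[OF b_real b_real] by (simp add: power2_eq_square)
  then have "3 * (real b)\<^sup>2 * \<bar>real_of_int m\<bar> \<le> 4 * ((real b)\<^sup>2 - 1) * \<bar>real_of_int m\<bar>"
    by (rule mult_right_mono) simp
  ultimately have "3 * (real b)\<^sup>2 * \<bar>real_of_int m\<bar> \<le> 4 * (real b * real b ^ n)"
    by linarith
  then have "real b * (3 * (real b * \<bar>real_of_int m\<bar>)) \<le> real b * (4 * real b ^ n)"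
    by (simp add: power2_eq_square mult_ac)
  then have "3 * (real b * \<bar>real_of_int m\<bar>) \<le> 4 * real b ^ n"
    using b_pos by (simp only: mult_le_cancel_left_pos)
  then show ?thesis
    using b_pos d_pos by (simp add: freq_def abs_mult field_simps)
qed

text \<open>
  One application of the recursion leaves a frequency at which \<open>cos (2 * pi * s * X)\<close> is at least
  \<open>1 / 2\<close> almost surely.
\<close>
lemma coef_one_lower_bound:
  assumes "d * \<bar>t\<bar> \<le> 2 / 3"
  shows "1 / 16 \<le> (cmod (coef (\<lambda>_. 1) t))\<^sup>2"
proof -
  have dt: "d * \<bar>t\<bar> / b \<le> 1 / 3"
    using assms b_real by (simp add: field_simps)
  then have "pi * (d * \<bar>t\<bar> / b) \<le> pi * (1 / 3)"
    by (rule mult_left_mono) simp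
  moreover have "\<bar>pi * d * t / b\<bar> = pi * (d * \<bar>t\<bar> / b)"
    using d_pos by (simp add: abs_mult)
  ultimately have 1: "1 / 2 \<le> cos (pi * d * t / b)"
    by (intro cos_ge_half) linarith
  define s where "s = t / b"
  have cos_X: "1 / 2 \<le> cos (2 * pi * s * X \<xi>)" if "\<forall>n. \<xi> n \<in> {-1, 1}" for \<xi>
  proof (rule cos_ge_half)
    have "\<bar>X \<xi>\<bar> \<le> d / (2 * (real b - 1))"
      by (rule abs_X_le[OF that])
    also have "\<dots> \<le> d / 2"
      using b_real d_pos by (intro divide_left_mono) auto
    finally have "\<bar>s\<bar> * \<bar>X \<xi>\<bar> \<le> \<bar>s\<bar> * (d / 2)"
      by (rule mult_left_mono) simp
    also have "\<dots> = d * \<bar>t\<bar> / b / 2"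
      by (simp add: s_def)
    also have "\<dots> \<le> 1 / 6"
      by (rule order_trans[OF divide_right_mono[OF dt, of 2]]) simp_all
    finally have "2 * pi * (\<bar>s\<bar> * \<bar>X \<xi>\<bar>) \<le> 2 * pi * (1 / 6)"
      by (rule mult_left_mono) simp
    then show "\<bar>2 * pi * s * X \<xi>\<bar> \<le> pi / 3"
      by (simp add: abs_mult mult_ac)
  qed
  have int: "integrable signs (\<lambda>\<xi>. cos (2 * pi * s * X \<xi>))"
    by (rule integrable_signs_bounded[of _ 1]) auto
  have "(LINT \<xi>|signs. 1 / 2) \<le> (LINT \<xi>|signs. cos (2 * pi * s * X \<xi>))"
  proof (rule integral_mono_AE)
    show "AE \<xi> in signs. 1 / 2 \<le> cos (2 * pi * s * X \<xi>)"
      using AE_signs by eventually_elim (rule cos_X)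
  qed (use int in auto)
  also have "\<dots> = (LINT \<xi>|signs. Re (1 * cnj (exponential s (X \<xi>))))"
    by (simp add: exponential_cis)
  also have "\<dots> = Re (coef (\<lambda>_. 1) s)"
    unfolding coef_def by (rule integral_Re) (rule integrable_coef, simp)
  also have "\<dots> \<le> cmod (coef (\<lambda>_. 1) s)"
    by (rule complex_Re_le_cmod)
  finally have 2: "1 / 2 \<le> cmod (coef (\<lambda>_. 1) s)"
    using signs_prob.prob_space by simp
  have "coef (\<lambda>_. 1) t = cos (pi * d * t / b) * coef (\<lambda>_. 1) s"
    unfolding s_def by (rule coef_shift) auto
  then have "cmod (coef (\<lambda>_. 1) t) = \<bar>cos (pi * d * t / b)\<bar> * cmod (coef (\<lambda>_. 1) s)"
    by (simp only: norm_mult norm_of_real)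
  moreover have "1 / 2 * (1 / 2) \<le> \<bar>cos (pi * d * t / b)\<bar> * cmod (coef (\<lambda>_. 1) s)"
    using 1 2 by (intro mult_mono) auto
  ultimately have "1 / 4 \<le> cmod (coef (\<lambda>_. 1) t)"
    by simp
  then have "(1 / 4)\<^sup>2 \<le> (cmod (coef (\<lambda>_. 1) t))\<^sup>2"
    by (intro power_mono) auto
  then show ?thesis
    by (simp add: power2_eq_square)
qed

section \<open>Even ratio: frame bounds\<close>

text \<open>
  This is where \<open>b\<close> has to be even: the contribution of \<open>m\<close> to the phase \<open>pi * d * t / b\<close> is
  \<open>pi * b * m / 2\<close>, a multiple of \<open>pi\<close>, so it changes both halves by the same sign. The function
  \<open>G\<close> therefore depends on the lowest digit \<open>a\<close> only.
\<close>
lemma parseval_step: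
  fixes m a \<sigma> :: int
  assumes "even b" "\<sigma> \<in> {-1, 1}" and F: "sq_integrable F"
    and t: "t = freq (int b * m + a * \<sigma>) + \<theta>"
  defines "\<alpha> \<equiv> pi * a * \<sigma> / 2 + pi * d * \<theta> / b"
  defines "G \<equiv> \<lambda>\<xi>. cis (- \<alpha>) / 2 * F (case_nat 1 \<xi>) + cis \<alpha> / 2 * F (case_nat (-1) \<xi>)"
  shows "cmod (coef F t) = cmod (coef G (freq m + (a * \<sigma> / (2 * d) + \<theta> / b)))"
proof -
  from assms(1) obtain k where k: "b = 2 * k" by (rule evenE)
  have tb: "t / b = freq m + (a * \<sigma> / (2 * d) + \<theta> / b)"
    using b_pos d_pos by (simp add: t freq_def field_simps)
  have ang: "pi * d * t / b = pi * real_of_int (int k * m) + \<alpha>"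
    using b_pos d_pos unfolding t freq_def \<alpha>_def by (simp add: k field_simps)
  define \<epsilon> where "\<epsilon> = cis (pi * real_of_int (int k * m))"
  have eps: "cis (- (pi * real_of_int (int k * m))) = \<epsilon>"
    using sin_times_pi_eq_0[of "real_of_int (int k * m)"]
    by (simp add: \<epsilon>_def complex_eq_iff mult.commute[of pi])
  have "cis (pi * d * t / b) = \<epsilon> * cis \<alpha>"
    unfolding ang \<epsilon>_def by (simp add: cis_mult)
  moreover have "cis (- (pi * d * t / b)) = \<epsilon> * cis (- \<alpha>)"
    unfolding ang eps[symmetric] by (simp add: cis_mult)
  moreover have "coef G (t / b) = cis (- \<alpha>) / 2 * coef (\<lambda>\<xi>. F (case_nat 1 \<xi>)) (t / b) +
      cis \<alpha> / 2 * coef (\<lambda>\<xi>. F (case_nat (-1) \<xi>)) (t / b)"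
    unfolding G_def by (intro coef_linear sq_integrable_first_sign F) auto
  ultimately have "coef F t = \<epsilon> * coef G (t / b)"
    unfolding coef_first_sign[OF sq_integrable_imp_integrable[OF F]] by (simp add: field_simps)
  then show ?thesis
    by (simp add: norm_mult \<epsilon>_def tb)
qed

text \<open>
  The translation \<open>\<theta>\<close> is needed for the induction, since the digit split off reappears as a
  translation of the remaining frequencies. The functions \<open>G 0\<close> and \<open>G 1\<close> obtained for the two
  values of the lowest digit are, up to phases, the half sum and half difference of the same two functions.
\<close>
lemma finite_parseval:
  assumes "even b" "\<sigma> \<in> {-1, 1}" "sq_integrable F" "depends_on_first n F"
    and "\<And>m. m \<in> freqs \<sigma> n \<Longrightarrow> \<kappa> \<le> (cmod (coef (\<lambda>_. 1) ((freq m + \<theta>) / b ^ n)))\<^sup>2"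
  shows "\<kappa> * sq_norm F \<le> (\<Sum>m\<in>freqs \<sigma> n. (cmod (coef F (freq m + \<theta>)))\<^sup>2) \<and>
         (\<Sum>m\<in>freqs \<sigma> n. (cmod (coef F (freq m + \<theta>)))\<^sup>2) \<le> sq_norm F"
  using assms(2-)
proof (induction n arbitrary: \<sigma> F \<theta>)
  case 0
  define c where "c = F (\<lambda>_. 0)"
  have F: "F = (\<lambda>_. c)"
    using 0 by (auto simp: depends_on_first_def c_def)
  have "coef F t = c * coef (\<lambda>_. 1) t" for t
    by (simp add: F coef_def)
  moreover have "sq_norm F = (cmod c)\<^sup>2"
    using signs_prob.prob_space by (simp add: F sq_norm_def)
  moreover have "(cmod (coef (\<lambda>_. 1) t))\<^sup>2 \<le> 1" for t
    using norm_coef_le[of "\<lambda>_. 1"] by (simp add: power_le_one)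
  moreover have "\<kappa> \<le> (cmod (coef (\<lambda>_. 1) \<theta>))\<^sup>2"
    using 0 by (simp add: freq_def)
  ultimately show ?case
    using mult_left_mono[of _ _ "(cmod c)\<^sup>2"]
    by (auto simp: freq_def norm_mult power_mult_distrib mult.commute[of \<kappa>] mult_left_le)
next
  case (Suc n)
  note F = Suc.prems(2)
  let ?Fp = "\<lambda>\<xi>. F (case_nat 1 \<xi>)" and ?Fm = "\<lambda>\<xi>. F (case_nat (-1) \<xi>)"
  define \<alpha> where "\<alpha> a = pi * real_of_int a * \<sigma> / 2 + pi * d * \<theta> / b" for a :: int
  define G where "G a = (\<lambda>\<xi>. cis (- \<alpha> a) / 2 * ?Fp \<xi> + cis (\<alpha> a) / 2 * ?Fm \<xi>)" for a
  define \<theta>' where "\<theta>' a = a * \<sigma> / (2 * d) + \<theta> / b" for a :: int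
  have G_sq: "sq_integrable (G a)" for a
    unfolding G_def by (intro sq_integrable_add sq_integrable_cmult sq_integrable_first_sign F) auto
  have IH: "\<kappa> * sq_norm (G a) \<le> (\<Sum>m\<in>freqs (-\<sigma>) n. (cmod (coef (G a) (freq m + \<theta>' a)))\<^sup>2) \<and>
      (\<Sum>m\<in>freqs (-\<sigma>) n. (cmod (coef (G a) (freq m + \<theta>' a)))\<^sup>2) \<le> sq_norm (G a)"
    if a: "a \<in> {0, 1}" for a
  proof (rule Suc.IH[OF _ G_sq])
    show "- \<sigma> \<in> {-1, 1}" using Suc.prems(1) by auto
    have *: "F (case_nat s \<xi>) = F (case_nat s \<eta>)" if "\<forall>i<n. \<xi> i = \<eta> i" for s \<xi> \<eta>
      using Suc.prems(3) that unfolding depends_on_first_def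
      by (auto simp: less_Suc_eq_0_disj split: nat.split)
    show "depends_on_first n (G a)"
      unfolding depends_on_first_def
    proof (intro allI impI)
      fix \<xi> \<eta> :: "nat \<Rightarrow> real" assume "\<forall>i<n. \<xi> i = \<eta> i"
      from *[OF this, of 1] *[OF this, of "-1"] show "G a \<xi> = G a \<eta>"
        by (simp add: G_def)
    qed
    fix m assume "m \<in> freqs (-\<sigma>) n"
    then have "int b * m + a * \<sigma> \<in> freqs \<sigma> (Suc n)" using a by auto
    moreover have "(freq (int b * m + a * \<sigma>) + \<theta>) / b ^ Suc n = (freq m + \<theta>' a) / b ^ n"
      using b_pos d_pos by (simp add: freq_def \<theta>'_def field_simps)
    ultimately show "\<kappa> \<le> (cmod (coef (\<lambda>_. 1) ((freq m + \<theta>' a) / b ^ n)))\<^sup>2"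
      using Suc.prems(4)[of "int b * m + a * \<sigma>"] by simp
  qed
  have split: "(\<Sum>m\<in>freqs \<sigma> (Suc n). (cmod (coef F (freq m + \<theta>)))\<^sup>2) =
      (\<Sum>m\<in>freqs (-\<sigma>) n. (cmod (coef (G 0) (freq m + \<theta>' 0)))\<^sup>2) +
      (\<Sum>m\<in>freqs (-\<sigma>) n. (cmod (coef (G 1) (freq m + \<theta>' 1)))\<^sup>2)"
    using parseval_step[OF assms(1) Suc.prems(1) F refl, of _ 0 \<theta>]
      parseval_step[OF assms(1) Suc.prems(1) F refl, of _ 1 \<theta>]
    unfolding sum_freqs_Suc[OF Suc.prems(1)] G_def \<alpha>_def \<theta>'_def by simp
  have "(cmod (G 0 \<xi>))\<^sup>2 + (cmod (G 1 \<xi>))\<^sup>2 = (cmod (?Fp \<xi>))\<^sup>2 / 2 + (cmod (?Fm \<xi>))\<^sup>2 / 2" for \<xi>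
  proof -
    define u v where "u = cis (- \<alpha> 0) / 2 * ?Fp \<xi>" and "v = cis (\<alpha> 0) / 2 * ?Fm \<xi>"
    have \<alpha>1: "\<alpha> 1 = \<alpha> 0 + \<sigma> * (pi / 2)"
      by (simp add: \<alpha>_def)
    have s: "cis (\<sigma> * (pi / 2)) = \<sigma> * \<i>" "cis (- (\<sigma> * (pi / 2))) = - (\<sigma> * \<i>)"
      using Suc.prems(1) by (auto simp: complex_eq_iff)
    have "cis (- \<alpha> 1) = - (\<sigma> * \<i>) * cis (- \<alpha> 0)"
      unfolding \<alpha>1 s(2)[symmetric] by (simp add: cis_mult algebra_simps)
    moreover have "cis (\<alpha> 1) = \<sigma> * \<i> * cis (\<alpha> 0)"
      unfolding \<alpha>1 s(1)[symmetric] by (simp add: cis_mult add.commute)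
    ultimately have "G 1 \<xi> = \<sigma> * \<i> * (v - u)"
      unfolding G_def u_def v_def by (simp add: algebra_simps)
    moreover have "cmod (\<sigma> * \<i>) = 1"
      using Suc.prems(1) by (auto simp: norm_mult)
    ultimately have "cmod (G 1 \<xi>) = cmod (v - u)"
      by (metis mult_1 norm_mult)
    moreover have "G 0 \<xi> = v + u"
      by (simp add: G_def u_def v_def)
    moreover have "(cmod (v + u))\<^sup>2 + (cmod (v - u))\<^sup>2 = 2 * (cmod u)\<^sup>2 + 2 * (cmod v)\<^sup>2"
      unfolding cmod_power2 by (simp add: power2_eq_square algebra_simps)
    moreover have "cmod u = cmod (?Fp \<xi>) / 2" "cmod v = cmod (?Fm \<xi>) / 2"
      by (simp_all add: u_def v_def norm_mult norm_divide)
    ultimately show ?thesis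
      by (simp add: power_divide)
  qed
  then have "(LINT \<xi>|signs. (cmod (G 0 \<xi>))\<^sup>2 + (cmod (G 1 \<xi>))\<^sup>2) =
      (LINT \<xi>|signs. (cmod (?Fp \<xi>))\<^sup>2 / 2 + (cmod (?Fm \<xi>))\<^sup>2 / 2)"
    by simp
  then have sum_G: "sq_norm F = sq_norm (G 0) + sq_norm (G 1)"
    using G_sq sq_integrable_first_sign[OF F]
    by (subst sq_norm_first_sign[OF F]) (simp add: sq_norm_def sq_integrable_def add_divide_distrib)
  from IH[of 0] IH[of 1] show ?case
    unfolding split sum_G distrib_left by simp
qed

definition energy :: "nat \<Rightarrow> ((nat \<Rightarrow> real) \<Rightarrow> complex) \<Rightarrow> real" where
  "energy n F = (\<Sum>m\<in>freqs 1 n. (cmod (coef F (freq m)))\<^sup>2)"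

lemma energy_mono: "n \<le> m \<Longrightarrow> energy n F \<le> energy m F"
  unfolding energy_def by (rule sum_mono2) (auto intro: freqs_mono[THEN subsetD])

lemma energy_add_le:
  assumes "sq_integrable F" "sq_integrable G"
  shows "energy n (\<lambda>\<xi>. F \<xi> + G \<xi>) \<le> 2 * energy n F + 2 * energy n G"
proof -
  have "coef (\<lambda>\<xi>. F \<xi> + G \<xi>) t = coef F t + coef G t" for t
    using coef_linear[OF assms, of 1 1] by simp
  then show ?thesis
    unfolding energy_def sum_distrib_left sum.distrib[symmetric]
    by (intro sum_mono) (simp add: norm_add_sq_le)
qed

lemma energy_cylinder:
  assumes "even b" "sq_integrable F" "depends_on_first n F"
  shows "1 / 16 * sq_norm F \<le> energy n F" "energy n F \<le> sq_norm F"
proof -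
  have "1 / 16 \<le> (cmod (coef (\<lambda>_. 1) ((freq m + 0) / b ^ n)))\<^sup>2" if "m \<in> freqs 1 n" for m
    using abs_freq_le[of 1 m n] that by (intro coef_one_lower_bound) auto
  from finite_parseval[OF assms(1) _ assms(2,3) this]
  show "1 / 16 * sq_norm F \<le> energy n F" "energy n F \<le> sq_norm F"
    by (auto simp: energy_def)
qed

text \<open>
  For fixed \<open>n\<close> the energy is continuous in \<open>L\<^sup>2\<close>, although with a modulus depending on \<open>n\<close>; this
  is harmless because the approximating function can be chosen after \<open>n\<close>.
\<close>
lemma energy_upper:
  assumes "even b" "sq_integrable F"
  shows "energy n F \<le> 4 * sq_norm F"
proof (rule field_le_epsilon)
  fix e :: real assume e: "e > 0"
  define N where "N = 4 + 2 * real (card (freqs 1 n))"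
  have N: "N > 0" by (simp add: N_def add_pos_nonneg)
  with e have "e / N > 0" by simp
  then obtain k G where G: "sq_integrable G" "depends_on_first k G" "sq_norm (\<lambda>\<xi>. F \<xi> - G \<xi>) < e / N"
    using approximable_sq_integrable[OF assms(2)] unfolding approximable_def by metis
  let ?H = "\<lambda>\<xi>. F \<xi> - G \<xi>"
  have H: "sq_integrable ?H" "sq_integrable (\<lambda>\<xi>. - 1 * ?H \<xi>)"
    using assms G by (intro sq_integrable_diff sq_integrable_cmult; simp)+
  have "energy n F \<le> 2 * energy n G + 2 * energy n ?H"
    using energy_add_le[OF G(1) H(1)] by simp
  also have "energy n G \<le> energy (max n k) G"
    by (rule energy_mono) simp
  also have "energy (max n k) G \<le> sq_norm G"
    using G by (intro energy_cylinder assms depends_on_first_mono[OF G(2)]) auto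
  also have "sq_norm G \<le> 2 * sq_norm F + 2 * sq_norm ?H"
    using sq_norm_add_le[OF assms(2) H(2)] sq_norm_cmult[of "-1" ?H] by simp
  also have "energy n ?H \<le> card (freqs 1 n) * sq_norm ?H"
    unfolding energy_def using norm_coef_sq_le[OF H(1)] by (intro sum_bounded_above) auto
  finally have "energy n F \<le> 4 * sq_norm F + N * sq_norm ?H"
    by (simp add: N_def algebra_simps)
  also have "N * sq_norm ?H \<le> e"
    using G(3) N by (simp add: field_simps)
  finally show "energy n F \<le> 4 * sq_norm F + e" by simp
qed

text \<open>
  The energy of the error of approximation is controlled by the upper bound, which does not depend
  on \<open>n\<close>; hence \<open>n\<close> may be chosen after the approximating function.
\<close>
lemma energy_lower:
  assumes "even b" "sq_integrable F" "\<And>n. energy n F \<le> E"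
  shows "1 / 64 * sq_norm F \<le> E"
proof (rule field_le_epsilon)
  fix e :: real assume e: "e > 0"
  then have "e / 8 > 0" by simp
  then obtain n G where G: "sq_integrable G" "depends_on_first n G" "sq_norm (\<lambda>\<xi>. F \<xi> - G \<xi>) < e / 8"
    using approximable_sq_integrable[OF assms(2)] unfolding approximable_def by metis
  let ?H = "\<lambda>\<xi>. F \<xi> - G \<xi>"
  have H: "sq_integrable ?H" "sq_integrable (\<lambda>\<xi>. - 1 * ?H \<xi>)"
    using assms G by (intro sq_integrable_diff sq_integrable_cmult; simp)+
  have "sq_norm F \<le> 2 * sq_norm G + 2 * sq_norm ?H"
    using sq_norm_add_le[OF G(1) H(1)] by simp
  moreover have "1 / 16 * sq_norm G \<le> energy n G"
    by (rule energy_cylinder[OF assms(1) G(1,2)])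
  moreover have "energy n G \<le> 2 * energy n F + 2 * energy n (\<lambda>\<xi>. - 1 * ?H \<xi>)"
    using energy_add_le[OF assms(2) H(2)] by simp
  moreover have "energy n (\<lambda>\<xi>. - 1 * ?H \<xi>) \<le> 4 * sq_norm ?H"
    using energy_upper[OF assms(1) H(2), of n] sq_norm_cmult[of "-1" ?H] by simp
  ultimately show "1 / 64 * sq_norm F \<le> E + e"
    using assms(3)[of n] G(3) e by linarith
qed

lemma admits_fourier_frame_even:
  assumes "even b"
  shows "admits_fourier_frame (bernoulli_convolution b d)"
proof -
  let ?\<mu> = "bernoulli_convolution b d"
  define L where "L = freq ` (\<Union>n. freqs 1 n)"
  have inj: "inj_on freq A" for A
    using b_pos d_pos by (auto simp: inj_on_def freq_def)
  have bounds: "(\<lambda>t. (cmod (L2_inner ?\<mu> f (exponential t)))\<^sup>2) summable_on L \<and>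
      1 / 64 * (L2_norm ?\<mu> f)\<^sup>2 \<le> (\<Sum>\<^sub>\<infinity>t\<in>L. (cmod (L2_inner ?\<mu> f (exponential t)))\<^sup>2) \<and>
      (\<Sum>\<^sub>\<infinity>t\<in>L. (cmod (L2_inner ?\<mu> f (exponential t)))\<^sup>2) \<le> 4 * (L2_norm ?\<mu> f)\<^sup>2"
    if f: "f \<in> L2_space ?\<mu>" for f
  proof -
    let ?F = "\<lambda>\<xi>. f (X \<xi>)"
    define p where "p t = (cmod (coef ?F t))\<^sup>2" for t
    have p: "(cmod (L2_inner ?\<mu> f (exponential t)))\<^sup>2 = p t" for t
      by (simp add: p_def L2_inner_eq_coef[OF f])
    have norm: "(L2_norm ?\<mu> f)\<^sup>2 = sq_norm ?F"
      by (simp add: sq_norm_def L2_norm_eq[OF f])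
    have F: "sq_integrable ?F"
      using L2_integrable[OF f] measurable_compose[OF X_measurable L2_measurable[OF f]]
      by (simp add: sq_integrable_def)
    have energy: "sum p (freq ` freqs 1 n) = energy n ?F" for n
      by (simp add: sum.reindex[OF inj] energy_def p_def)
    have finite_sums: "sum p T \<le> 4 * sq_norm ?F" if T: "finite T" "T \<subseteq> L" for T
    proof -
      have "\<exists>n. T \<subseteq> freq ` freqs 1 n"
        using T
      proof (induction T rule: finite_induct)
        case (insert t T)
        then obtain n m where "T \<subseteq> freq ` freqs 1 n" "t \<in> freq ` freqs 1 m"
          unfolding L_def by auto
        moreover have "freqs 1 n \<subseteq> freqs 1 (max n m)" "freqs 1 m \<subseteq> freqs 1 (max n m)"
          by (intro freqs_mono; simp)+
        ultimately have "insert t T \<subseteq> freq ` freqs 1 (max n m)" by blast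
        then show ?case by blast
      qed auto
      then obtain n where "T \<subseteq> freq ` freqs 1 n" ..
      then have "sum p T \<le> sum p (freq ` freqs 1 n)"
        by (intro sum_mono2) (auto simp: p_def)
      also have "\<dots> \<le> 4 * sq_norm ?F"
        unfolding energy by (rule energy_upper[OF assms F])
      finally show ?thesis .
    qed
    have summable: "p summable_on L"
      by (rule nonneg_bdd_above_summable_on) (auto simp: p_def[symmetric] intro!: bdd_aboveI finite_sums, simp add: p_def)
    have "infsum p L \<le> 4 * sq_norm ?F"
      using summable finite_sums by (rule infsum_le_finite_sums)
    moreover have "1 / 64 * sq_norm ?F \<le> infsum p L"
    proof (rule energy_lower[OF assms F])
      show "energy n ?F \<le> infsum p L" for n
        unfolding energy[symmetric] using summable
        by (rule finite_sum_le_infsum) (auto simp: L_def p_def)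
    qed
    ultimately show ?thesis
      unfolding p norm using summable by simp
  qed
  have "countable L"
    by (simp add: L_def countable_finite)
  then have "fourier_frame_spectrum ?\<mu> L"
    unfolding fourier_frame_spectrum_def
  proof (intro conjI)
    show "\<exists>A C. 0 < A \<and> A \<le> C \<and> (\<forall>f\<in>L2_space ?\<mu>.
        (\<lambda>t. (cmod (L2_inner ?\<mu> f (exponential t)))\<^sup>2) summable_on L \<and>
        A * (L2_norm ?\<mu> f)\<^sup>2 \<le> (\<Sum>\<^sub>\<infinity>t\<in>L. (cmod (L2_inner ?\<mu> f (exponential t)))\<^sup>2) \<and>
        (\<Sum>\<^sub>\<infinity>t\<in>L. (cmod (L2_inner ?\<mu> f (exponential t)))\<^sup>2) \<le> C * (L2_norm ?\<mu> f)\<^sup>2)"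
      by (rule exI[of _ "1 / 64"], rule exI[of _ 4], intro conjI ballI bounds) simp_all
  qed
  then show ?thesis
    unfolding admits_fourier_frame_def ..
qed

end

theorem mainTheorem2:
  fixes b :: nat and d :: real
  assumes "b \<ge> 2" and "d > 0"
  shows "admits_fourier_frame (bernoulli_convolution b d) \<longleftrightarrow> even b"
proof -
  interpret bernoulli_sum b d
    using assms by unfold_locales
  show ?thesis
    using admits_fourier_frame_even not_admits_fourier_frame_odd by blast
qed

end
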